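(* (Provable in $\mathsf{C}$.) Let $\mathfrak S$ be a $\rho$-structure (possibly a proper class), and let $\psi,\psi'$ be $\rho$-formulas such that a $\{\psi\}$-satisfaction relation and a $\{\psi'\}$-satisfaction relation for $\mathfrak S$ exist. Suppose $\phi$ is obtained from $\psi$ and/or $\psi'$ by a single formula-building operation: $\neg$, $\vee$, $\wedge$, $\rightarrow$, $\leftrightarrow$, $\exists v$, or $\forall v$ (for a variable $v$). Then a $\{\phi\}$-satisfaction relation for $\mathfrak S$ exists.
   Context: $\mathsf{C}$ denotes Gödel–Bernays class theory $\mathsf{GB}$ with the Axiom of Infinity omitted (sets and classes; class comprehension only for formulas without bound class variables). Structures may be proper classes; $|\mathfrak S|$ is the universe. For an expression $\epsilon$, an $\mathfrak S$-assignment for $\epsilon$ is a finite function into $|\mathfrak S|$ whose domain contains the free variables of $\epsilon$. For a class $\Phi$ of $\rho$-expressions, $\mathrm{Sub}(\Phi)$ is the class of subexpressions of members of $\Phi$. A $\Phi$-valuation function for $\mathfrak S$ is a function $F$ defined exactly on pairs $\langle\epsilon,A\rangle$ with $\epsilon\in\mathrm{Sub}(\Phi)$ and $A$ an $\mathfrak S$-assignment for $\epsilon$, taking values in $|\mathfrak S|$ for terms and in $\{0,1\}$ for formulas, and obeying the usual Tarskian recursive clauses. The corresponding $\Phi$-satisfaction relation is the class of $\langle\phi,A\rangle$ with $\phi$ a formula and $F\langle\phi,A\rangle=1$. *)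

theory Defs
  imports Main
begin

text \<open>
  Goedel--Bernays class theory without the axiom of infinity is rendered as an axiomatic type
  class: a type of that class is a model of the theory, its elements are the classes of the
  model, and the sets are the classes that are members of some class.  A proposition about an
  arbitrary such type that only quantifies over its elements says that a first-order sentence
  holds in every model, i.e. that it is provable.

  Everything below (natural numbers, finiteness, expressions, subexpressions, assignments,
  valuations) is therefore internal to the model.  HOL's own numbers, lists, datatypes and
  inductive definitions are not used for these notions, as they would only capture the standard
  expressions of a possibly nonstandard model.
\<close>

section \<open>The class theory\<close>

text \<open>Formulas of class theory without bound class variables: the quantifier ranges over sets.\<close>

datatype predicative_formula =
    PMem nat nat
  | PEq nat nat
  | PNeg predicative_formula
  | PAnd predicative_formula predicative_formula
  | PExSet nat predicative_formula

class membership =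
  fixes mem :: "'a \<Rightarrow> 'a \<Rightarrow> bool"  (infix "\<in>\<^sub>c" 50)
begin

definition is_set :: "'a \<Rightarrow> bool" where
  "is_set x \<longleftrightarrow> (\<exists>y. x \<in>\<^sub>c y)"

primrec holds :: "predicative_formula \<Rightarrow> (nat \<Rightarrow> 'a) \<Rightarrow> bool" where
  "holds (PMem i j) s \<longleftrightarrow> s i \<in>\<^sub>c s j"
| "holds (PEq i j) s \<longleftrightarrow> s i = s j"
| "holds (PNeg p) s \<longleftrightarrow> \<not> holds p s"
| "holds (PAnd p q) s \<longleftrightarrow> holds p s \<and> holds q s"
| "holds (PExSet i p) s \<longleftrightarrow> (\<exists>x. is_set x \<and> holds p (s(i := x)))"

text \<open>
  The guard \<^term>\<open>is_set z\<close> makes the pair exist for all classes \<^term>\<open>a\<close> and \<^term>\<open>b\<close>.  It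
  is the usual pair only when both are sets, so sethood is always assumed where pairs are used.
\<close>

definition upair :: "'a \<Rightarrow> 'a \<Rightarrow> 'a" where
  "upair a b = (THE p. \<forall>z. z \<in>\<^sub>c p \<longleftrightarrow> is_set z \<and> (z = a \<or> z = b))"

definition opair :: "'a \<Rightarrow> 'a \<Rightarrow> 'a" where
  "opair a b = upair (upair a a) (upair a b)"

definition maps :: "'a \<Rightarrow> 'a \<Rightarrow> 'a \<Rightarrow> bool" where
  "maps f x y \<longleftrightarrow> is_set x \<and> is_set y \<and> opair x y \<in>\<^sub>c f"

end

text \<open>
  Existence of a set is listed separately because the axiom of infinity, which would otherwise
  provide one, is omitted.  There is no axiom of choice.
\<close>

class gb_without_infinity = membership +
  assumes extensionality: "(\<forall>z. z \<in>\<^sub>c x \<longleftrightarrow> z \<in>\<^sub>c y) \<Longrightarrow> x = y"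
    and comprehension: "\<exists>X. \<forall>x. x \<in>\<^sub>c X \<longleftrightarrow> is_set x \<and> holds p (s(i := x))"
    and set_existence: "\<exists>x. is_set x"
    and pairing: "is_set a \<Longrightarrow> is_set b \<Longrightarrow>
      \<exists>p. is_set p \<and> (\<forall>z. z \<in>\<^sub>c p \<longleftrightarrow> z = a \<or> z = b)"
    and union: "is_set a \<Longrightarrow>
      \<exists>u. is_set u \<and> (\<forall>z. z \<in>\<^sub>c u \<longleftrightarrow> (\<exists>y. z \<in>\<^sub>c y \<and> y \<in>\<^sub>c a))"
    and powerset: "is_set a \<Longrightarrow>
      \<exists>u. is_set u \<and> (\<forall>z. z \<in>\<^sub>c u \<longleftrightarrow> is_set z \<and> (\<forall>y. y \<in>\<^sub>c z \<longrightarrow> y \<in>\<^sub>c a))"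
    and replacement: "(\<forall>x y y'. maps f x y \<and> maps f x y' \<longrightarrow> y = y') \<Longrightarrow> is_set a \<Longrightarrow>
      \<exists>b. is_set b \<and> (\<forall>y. y \<in>\<^sub>c b \<longleftrightarrow> (\<exists>x. x \<in>\<^sub>c a \<and> maps f x y))"
    and foundation: "\<exists>x. x \<in>\<^sub>c X \<Longrightarrow> \<exists>x. x \<in>\<^sub>c X \<and> \<not> (\<exists>y. y \<in>\<^sub>c x \<and> y \<in>\<^sub>c X)"

abbreviation set_ex :: "('c::membership \<Rightarrow> bool) \<Rightarrow> bool"  (binder "\<exists>\<^sub>s" 10) where
  "\<exists>\<^sub>s x. P x \<equiv> \<exists>x. is_set x \<and> P x"

abbreviation set_all :: "('c::membership \<Rightarrow> bool) \<Rightarrow> bool"  (binder "\<forall>\<^sub>s" 10) where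
  "\<forall>\<^sub>s x. P x \<equiv> \<forall>x. is_set x \<longrightarrow> P x"


section \<open>Functions, natural numbers, finiteness\<close>

definition singleton :: "'c::gb_without_infinity \<Rightarrow> 'c" where
  "singleton a = upair a a"

definition empty_class :: "'c::gb_without_infinity" where
  "empty_class = (THE e. \<forall>z. \<not> z \<in>\<^sub>c e)"

definition successor :: "'c::gb_without_infinity \<Rightarrow> 'c" where
  "successor n = (THE m. \<forall>z. z \<in>\<^sub>c m \<longleftrightarrow> z \<in>\<^sub>c n \<or> (is_set z \<and> z = n))"

text \<open>Numerals; only finitely many of them are used, as tags and truth values.\<close>

primrec num :: "nat \<Rightarrow> 'c::gb_without_infinity" where
  "num 0 = empty_class"
| "num (Suc k) = successor (num k)"

definition is_transitive :: "'c::gb_without_infinity \<Rightarrow> bool" where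
  "is_transitive x \<longleftrightarrow> (\<forall>y z. z \<in>\<^sub>c y \<and> y \<in>\<^sub>c x \<longrightarrow> z \<in>\<^sub>c x)"

text \<open>
  The natural numbers are the finite von Neumann ordinals.  (By foundation, an ordinal is a
  transitive set of transitive sets.)  They need not form a set.
\<close>

definition is_natural :: "'c::gb_without_infinity \<Rightarrow> bool" where
  "is_natural n \<longleftrightarrow> is_set n \<and> is_transitive n \<and> (\<forall>m. m \<in>\<^sub>c n \<longrightarrow> is_transitive m) \<and>
     (\<forall>m. m = n \<or> m \<in>\<^sub>c n \<longrightarrow> m = empty_class \<or> (\<exists>k. k \<in>\<^sub>c m \<and> m = successor k))"

definition is_function :: "'c::gb_without_infinity \<Rightarrow> bool" where
  "is_function f \<longleftrightarrow>
     (\<forall>p. p \<in>\<^sub>c f \<longrightarrow> (\<exists>\<^sub>s x. \<exists>\<^sub>s y. p = opair x y)) \<and>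
     (\<forall>x y y'. maps f x y \<and> maps f x y' \<longrightarrow> y = y')"

definition in_dom :: "'c::gb_without_infinity \<Rightarrow> 'c \<Rightarrow> bool" where
  "in_dom x f \<longleftrightarrow> (\<exists>y. maps f x y)"

text \<open>A finite sequence of length \<^term>\<open>n\<close>, with entries satisfying \<^term>\<open>P\<close>.\<close>

definition is_tuple :: "'c::gb_without_infinity \<Rightarrow> ('c \<Rightarrow> bool) \<Rightarrow> 'c \<Rightarrow> bool" where
  "is_tuple n P a \<longleftrightarrow> is_natural n \<and> is_set a \<and> is_function a \<and>
     (\<forall>i. in_dom i a \<longleftrightarrow> i \<in>\<^sub>c n) \<and> (\<forall>i y. maps a i y \<longrightarrow> P y)"

definition is_finite :: "'c::gb_without_infinity \<Rightarrow> bool" where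
  "is_finite x \<longleftrightarrow> is_set x \<and>
     (\<exists>n b. is_tuple n (\<lambda>y. y \<in>\<^sub>c x) b \<and>
        (\<forall>y. y \<in>\<^sub>c x \<longrightarrow> (\<exists>i. maps b i y)) \<and>
        (\<forall>i j y. maps b i y \<and> maps b j y \<longrightarrow> i = j))"


section \<open>Signatures and structures\<close>

text \<open>
  The two components are classes (possibly proper): functions assigning a natural number to each
  function symbol and to each relation symbol.  Constants are the function symbols of arity
  zero.
\<close>

record 'c signature =
  fun_arity :: 'c
  rel_arity :: 'c

definition is_signature :: "'c::gb_without_infinity signature \<Rightarrow> bool" where
  "is_signature \<rho> \<longleftrightarrow>
     is_function (fun_arity \<rho>) \<and> (\<forall>f n. maps (fun_arity \<rho>) f n \<longrightarrow> is_natural n) \<and>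
     is_function (rel_arity \<rho>) \<and> (\<forall>r n. maps (rel_arity \<rho>) r n \<longrightarrow> is_natural n)"

text \<open>
  All three components are classes.  The interpretation of the function symbols is a function on
  the pairs of a symbol and an argument tuple, that of the relation symbols a class of such
  pairs.  Neither the universe nor the signature is required to be nonempty.
\<close>

record 'c class_structure =
  universe :: 'c
  fun_interp :: 'c
  rel_interp :: 'c

definition is_structure :: "'c::gb_without_infinity signature \<Rightarrow> 'c class_structure \<Rightarrow> bool" where
  "is_structure \<rho> \<SS> \<longleftrightarrow>
     is_function (fun_interp \<SS>) \<and>
     (\<forall>p. in_dom p (fun_interp \<SS>) \<longleftrightarrow>
        (\<exists>f n a. maps (fun_arity \<rho>) f n \<and> is_tuple n (\<lambda>y. y \<in>\<^sub>c universe \<SS>) a \<and>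
          p = opair f a)) \<and>
     (\<forall>p y. maps (fun_interp \<SS>) p y \<longrightarrow> y \<in>\<^sub>c universe \<SS>) \<and>
     (\<forall>p. p \<in>\<^sub>c rel_interp \<SS> \<longrightarrow>
        (\<exists>r n a. maps (rel_arity \<rho>) r n \<and> is_tuple n (\<lambda>y. y \<in>\<^sub>c universe \<SS>) a \<and>
          p = opair r a))"


section \<open>Expressions\<close>

definition Var :: "'c::gb_without_infinity \<Rightarrow> 'c" where
  "Var n = opair (num 0) n"

definition FunApp :: "'c::gb_without_infinity \<Rightarrow> 'c \<Rightarrow> 'c" where
  "FunApp f a = opair (num 1) (opair f a)"

definition Equal :: "'c::gb_without_infinity \<Rightarrow> 'c \<Rightarrow> 'c" where
  "Equal t u = opair (num 2) (opair t u)"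

definition RelApp :: "'c::gb_without_infinity \<Rightarrow> 'c \<Rightarrow> 'c" where
  "RelApp r a = opair (num 3) (opair r a)"

definition Neg :: "'c::gb_without_infinity \<Rightarrow> 'c" where
  "Neg p = opair (num 4) p"

definition Or :: "'c::gb_without_infinity \<Rightarrow> 'c \<Rightarrow> 'c" where
  "Or p q = opair (num 5) (opair p q)"

definition And :: "'c::gb_without_infinity \<Rightarrow> 'c \<Rightarrow> 'c" where
  "And p q = opair (num 6) (opair p q)"

definition Imp :: "'c::gb_without_infinity \<Rightarrow> 'c \<Rightarrow> 'c" where
  "Imp p q = opair (num 7) (opair p q)"

definition Iff :: "'c::gb_without_infinity \<Rightarrow> 'c \<Rightarrow> 'c" where
  "Iff p q = opair (num 8) (opair p q)"

definition ExQ :: "'c::gb_without_infinity \<Rightarrow> 'c \<Rightarrow> 'c" where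
  "ExQ v p = opair (num 9) (opair v p)"

definition AllQ :: "'c::gb_without_infinity \<Rightarrow> 'c \<Rightarrow> 'c" where
  "AllQ v p = opair (num 10) (opair v p)"

definition is_var :: "'c::gb_without_infinity \<Rightarrow> bool" where
  "is_var v \<longleftrightarrow> (\<exists>n. is_natural n \<and> v = Var n)"

definition term_shaped :: "'c::gb_without_infinity \<Rightarrow> bool" where
  "term_shaped e \<longleftrightarrow> is_var e \<or> (\<exists>\<^sub>s f. \<exists>\<^sub>s a. e = FunApp f a)"

text \<open>\<^term>\<open>e\<close> is formed in one step from expressions satisfying \<^term>\<open>P\<close>.\<close>

definition formation_step ::
    "'c::gb_without_infinity signature \<Rightarrow> ('c \<Rightarrow> bool) \<Rightarrow> 'c \<Rightarrow> bool" where
  "formation_step \<rho> P e \<longleftrightarrow>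
     (let T = (\<lambda>t. P t \<and> term_shaped t); Q = (\<lambda>p. P p \<and> \<not> term_shaped p) in
       is_var e \<or>
       (\<exists>f n a. maps (fun_arity \<rho>) f n \<and> is_tuple n T a \<and> e = FunApp f a) \<or>
       (\<exists>t u. T t \<and> T u \<and> e = Equal t u) \<or>
       (\<exists>r n a. maps (rel_arity \<rho>) r n \<and> is_tuple n T a \<and> e = RelApp r a) \<or>
       (\<exists>p. Q p \<and> e = Neg p) \<or>
       (\<exists>p q. Q p \<and> Q q \<and> (e = Or p q \<or> e = And p q \<or> e = Imp p q \<or> e = Iff p q)) \<or>
       (\<exists>v p. is_var v \<and> Q p \<and> (e = ExQ v p \<or> e = AllQ v p)))"

text \<open>
  Expressions are the last entries of finite formation sequences, each of whose entries is formed
  from earlier ones.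
\<close>

definition is_expression :: "'c::gb_without_infinity signature \<Rightarrow> 'c \<Rightarrow> bool" where
  "is_expression \<rho> e \<longleftrightarrow>
     (\<exists>s n. is_natural n \<and> is_tuple (successor n) is_set s \<and> maps s n e \<and>
       (\<forall>i d. maps s i d \<longrightarrow> formation_step \<rho> (\<lambda>c. \<exists>j. j \<in>\<^sub>c i \<and> maps s j c) d))"

definition is_term :: "'c::gb_without_infinity signature \<Rightarrow> 'c \<Rightarrow> bool" where
  "is_term \<rho> e \<longleftrightarrow> is_expression \<rho> e \<and> term_shaped e"

definition is_formula :: "'c::gb_without_infinity signature \<Rightarrow> 'c \<Rightarrow> bool" where
  "is_formula \<rho> e \<longleftrightarrow> is_expression \<rho> e \<and> \<not> term_shaped e"

text \<open>The variable in a quantifier prefix is not an immediate subexpression.\<close>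

definition immediate_sub :: "'c::gb_without_infinity \<Rightarrow> 'c \<Rightarrow> bool" where
  "immediate_sub c e \<longleftrightarrow> is_set c \<and>
     ((\<exists>\<^sub>s f. \<exists>\<^sub>s a. (e = FunApp f a \<or> e = RelApp f a) \<and> (\<exists>i. maps a i c)) \<or>
      (\<exists>\<^sub>s t. \<exists>\<^sub>s u. e = Equal t u \<and> (c = t \<or> c = u)) \<or>
      e = Neg c \<or>
      (\<exists>\<^sub>s p. \<exists>\<^sub>s q. (e = Or p q \<or> e = And p q \<or> e = Imp p q \<or> e = Iff p q) \<and>
        (c = p \<or> c = q)) \<or>
      (\<exists>\<^sub>s v. e = ExQ v c \<or> e = AllQ v c))"

text \<open>
  Reflexive-transitive closure of the previous relation.  It suffices to intersect over the
  closed sets (rather than classes), since the entries of a formation sequence form one.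
\<close>

definition subexpression :: "'c::gb_without_infinity \<Rightarrow> 'c \<Rightarrow> bool" where
  "subexpression c e \<longleftrightarrow>
     (\<forall>\<^sub>s W. e \<in>\<^sub>c W \<and> (\<forall>d b. d \<in>\<^sub>c W \<and> immediate_sub b d \<longrightarrow> b \<in>\<^sub>c W) \<longrightarrow> c \<in>\<^sub>c W)"

definition in_Sub :: "'c::gb_without_infinity \<Rightarrow> 'c \<Rightarrow> bool" where
  "in_Sub \<Phi> c \<longleftrightarrow> (\<exists>e. e \<in>\<^sub>c \<Phi> \<and> subexpression c e)"

definition binds :: "'c::gb_without_infinity \<Rightarrow> 'c \<Rightarrow> bool" where
  "binds v e \<longleftrightarrow> (\<exists>\<^sub>s p. e = ExQ v p \<or> e = AllQ v p)"

text \<open>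
  The variable is reached from the expression by descending through immediate subexpressions
  without passing a quantifier that binds it.
\<close>

definition free_in :: "'c::gb_without_infinity \<Rightarrow> 'c \<Rightarrow> bool" where
  "free_in v e \<longleftrightarrow> is_var v \<and>
     (\<forall>\<^sub>s W. e \<in>\<^sub>c W \<and> (\<forall>d b. d \<in>\<^sub>c W \<and> immediate_sub b d \<and> \<not> binds v d \<longrightarrow> b \<in>\<^sub>c W)
       \<longrightarrow> v \<in>\<^sub>c W)"


section \<open>Valuation functions and satisfaction relations\<close>

definition is_assignment :: "'c::gb_without_infinity class_structure \<Rightarrow> 'c \<Rightarrow> 'c \<Rightarrow> bool" where
  "is_assignment \<SS> e A \<longleftrightarrow>
     is_finite A \<and> is_function A \<and> (\<forall>v x. maps A v x \<longrightarrow> x \<in>\<^sub>c universe \<SS>) \<and>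
     (\<forall>v. free_in v e \<longrightarrow> in_dom v A)"

definition update :: "'c::gb_without_infinity \<Rightarrow> 'c \<Rightarrow> 'c \<Rightarrow> 'c" where
  "update A v x =
     (THE B. \<forall>z. z \<in>\<^sub>c B \<longleftrightarrow> (z \<in>\<^sub>c A \<and> \<not> (\<exists>\<^sub>s y. z = opair v y)) \<or> z = opair v x)"

definition val :: "'c::gb_without_infinity \<Rightarrow> 'c \<Rightarrow> 'c \<Rightarrow> 'c \<Rightarrow> bool" where
  "val F e A y \<longleftrightarrow> maps F (opair e A) y"

definition true_at :: "'c::gb_without_infinity \<Rightarrow> 'c \<Rightarrow> 'c \<Rightarrow> bool" where
  "true_at F e A \<longleftrightarrow> val F e A (num 1)"

text \<open>\<^term>\<open>b\<close> is the tuple of the values of the entries of the tuple \<^term>\<open>a\<close> of terms.\<close>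

definition value_tuple :: "'c::gb_without_infinity \<Rightarrow> 'c \<Rightarrow> 'c \<Rightarrow> 'c \<Rightarrow> bool" where
  "value_tuple F A a b \<longleftrightarrow> is_set b \<and> is_function b \<and>
     (\<forall>i x. maps b i x \<longleftrightarrow> (\<exists>t. maps a i t \<and> val F t A x))"

definition tarskian_at ::
    "'c::gb_without_infinity class_structure \<Rightarrow> 'c \<Rightarrow> 'c \<Rightarrow> 'c \<Rightarrow> bool" where
  "tarskian_at \<SS> F e A \<longleftrightarrow>
     (is_var e \<longrightarrow> (\<forall>x. val F e A x \<longleftrightarrow> maps A e x)) \<and>
     (\<forall>\<^sub>s f. \<forall>\<^sub>s a. e = FunApp f a \<longrightarrow>
        (\<forall>x. val F e A x \<longleftrightarrow> (\<exists>b. value_tuple F A a b \<and> maps (fun_interp \<SS>) (opair f b) x))) \<and>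
     (\<forall>\<^sub>s t. \<forall>\<^sub>s u. e = Equal t u \<longrightarrow>
        (true_at F e A \<longleftrightarrow> (\<exists>x. val F t A x \<and> val F u A x))) \<and>
     (\<forall>\<^sub>s r. \<forall>\<^sub>s a. e = RelApp r a \<longrightarrow>
        (true_at F e A \<longleftrightarrow> (\<exists>b. value_tuple F A a b \<and> opair r b \<in>\<^sub>c rel_interp \<SS>))) \<and>
     (\<forall>\<^sub>s p. e = Neg p \<longrightarrow> (true_at F e A \<longleftrightarrow> \<not> true_at F p A)) \<and>
     (\<forall>\<^sub>s p. \<forall>\<^sub>s q. e = Or p q \<longrightarrow> (true_at F e A \<longleftrightarrow> true_at F p A \<or> true_at F q A)) \<and>
     (\<forall>\<^sub>s p. \<forall>\<^sub>s q. e = And p q \<longrightarrow> (true_at F e A \<longleftrightarrow> true_at F p A \<and> true_at F q A)) \<and>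
     (\<forall>\<^sub>s p. \<forall>\<^sub>s q. e = Imp p q \<longrightarrow> (true_at F e A \<longleftrightarrow> (true_at F p A \<longrightarrow> true_at F q A))) \<and>
     (\<forall>\<^sub>s p. \<forall>\<^sub>s q. e = Iff p q \<longrightarrow> (true_at F e A \<longleftrightarrow> (true_at F p A \<longleftrightarrow> true_at F q A))) \<and>
     (\<forall>\<^sub>s v. \<forall>\<^sub>s p. e = ExQ v p \<longrightarrow>
        (true_at F e A \<longleftrightarrow> (\<exists>x. x \<in>\<^sub>c universe \<SS> \<and> true_at F p (update A v x)))) \<and>
     (\<forall>\<^sub>s v. \<forall>\<^sub>s p. e = AllQ v p \<longrightarrow>
        (true_at F e A \<longleftrightarrow> (\<forall>x. x \<in>\<^sub>c universe \<SS> \<longrightarrow> true_at F p (update A v x))))"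

definition is_valuation ::
    "'c::gb_without_infinity signature \<Rightarrow> 'c class_structure \<Rightarrow> 'c \<Rightarrow> 'c \<Rightarrow> bool" where
  "is_valuation \<rho> \<SS> \<Phi> F \<longleftrightarrow>
     is_function F \<and>
     (\<forall>p. in_dom p F \<longleftrightarrow>
        (\<exists>e A. in_Sub \<Phi> e \<and> is_assignment \<SS> e A \<and> p = opair e A)) \<and>
     (\<forall>e A. in_Sub \<Phi> e \<and> is_assignment \<SS> e A \<longrightarrow>
        (is_term \<rho> e \<longrightarrow> (\<forall>y. val F e A y \<longrightarrow> y \<in>\<^sub>c universe \<SS>)) \<and>
        (is_formula \<rho> e \<longrightarrow> (\<forall>y. val F e A y \<longrightarrow> y = num 0 \<or> y = num 1)) \<and>
        tarskian_at \<SS> F e A)"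

definition is_satisfaction_relation ::
    "'c::gb_without_infinity signature \<Rightarrow> 'c class_structure \<Rightarrow> 'c \<Rightarrow> 'c \<Rightarrow> bool" where
  "is_satisfaction_relation \<rho> \<SS> \<Phi> R \<longleftrightarrow>
     (\<exists>F. is_valuation \<rho> \<SS> \<Phi> F \<and>
       (\<forall>z. z \<in>\<^sub>c R \<longleftrightarrow>
         (\<exists>\<^sub>s \<phi>. \<exists>\<^sub>s A. z = opair \<phi> A \<and> is_formula \<rho> \<phi> \<and> val F \<phi> A (num 1))))"

end

theory Submission
  imports Defs
begin

text \<open>
  Valuations of two classes of expressions agree on every common subexpression: the formation
  sequence of an expression has an entry of least index at which they differ, by foundation, and
  the Tarskian clauses determine the value there from the values at earlier entries.  The union
  of the valuations for the two given formulas is therefore a valuation, and it only remains to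
  add the values of the new formula, unless that is already a subexpression of the given ones.
  All of this needs only predicative comprehension, since the added values refer to the given
  valuations as class parameters and quantify over sets only.
\<close>

section \<open>Definable predicates\<close>

text \<open>Every induction must be an instance of foundation for a class that exists, and existence
  comes from comprehension, an axiom about codes of type \<open>predicative_formula\<close>. Writing
  such codes by hand is avoided by the semantic predicate \<open>definable\<close>, which asserts
  that some code with parameters expresses a given predicate of environments. Its closure under
  connectives, set quantifiers and class terms turns each instance of comprehension into an
  application of introduction rules. This shapes the later statements: the property proved by
  induction mentions only values of the two valuations, and conditions about a fixed formula enter
  as constant truth values. In this way neither being a formula nor being a subexpression has to be
  expressed by a code.\<close>

primrec relabel :: "(nat \<Rightarrow> nat) \<Rightarrow> predicative_formula \<Rightarrow> predicative_formula" where
  "relabel f (PMem i j) = PMem (f i) (f j)"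
| "relabel f (PEq i j) = PEq (f i) (f j)"
| "relabel f (PNeg p) = PNeg (relabel f p)"
| "relabel f (PAnd p q) = PAnd (relabel f p) (relabel f q)"
| "relabel f (PExSet i p) = PExSet (f i) (relabel f p)"

text \<open>Injectivity prevents capture: overwriting position \<open>f i\<close> must leave the
  images of all other positions unchanged.\<close>

lemma holds_relabel:
  assumes "inj f"
  shows "holds (relabel f p) s \<longleftrightarrow> holds p (s \<circ> f)"
proof (induction p arbitrary: s)
  case (PExSet i p)
  have "s(f i := x) \<circ> f = (s \<circ> f)(i := x)" for x
    using assms by (auto simp: fun_eq_iff inj_eq)
  then show ?case by (simp only: holds.simps relabel.simps PExSet)
qed simp_all

text \<open>
  Even positions are free variables in de Bruijn order, odd positions are constants (arbitrary
  classes).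
\<close>

definition environment :: "(nat \<Rightarrow> 'a) \<Rightarrow> (nat \<Rightarrow> 'a) \<Rightarrow> nat \<Rightarrow> 'a" where
  "environment c s n = (if even n then s (n div 2) else c (n div 2))"

definition definable :: "((nat \<Rightarrow> 'c::membership) \<Rightarrow> bool) \<Rightarrow> bool" where
  "definable P \<longleftrightarrow> (\<exists>p c. \<forall>s. P s \<longleftrightarrow> holds p (environment c s))"

lemma definableI: "(\<And>s. P s \<longleftrightarrow> holds p (environment c s)) \<Longrightarrow> definable P"
  unfolding definable_def by blast

lemma definable_neg: "definable P \<Longrightarrow> definable (\<lambda>s. \<not> P s)"
  unfolding definable_def by (metis holds.simps(3))

lemma definable_conj:
  assumes "definable P" "definable Q"
  shows "definable (\<lambda>s. P s \<and> Q s)"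
proof -
  from assms obtain p c q d
    where P: "\<And>s. P s \<longleftrightarrow> holds p (environment c s)"
      and Q: "\<And>s. Q s \<longleftrightarrow> holds q (environment d s)"
    unfolding definable_def by blast
  \<comment> \<open>\<open>b\<close> interleaves the two parameter streams: the parameter of
    \<open>P\<close> at \<open>2 * k + 1\<close> moves to \<open>4 * k + 1\<close>, that of
    \<open>Q\<close> to \<open>4 * k + 3\<close>. The shared variables at even positions stay in
    place.\<close>
  define f where "f n = (if even n then n else 2 * n - 1)" for n :: nat
  define g where "g n = (if even n then n else 2 * n + 1)" for n :: nat
  define b where "b n = (if even n then c (n div 2) else d (n div 2))" for n
  have inj: "inj f" "inj g"
    unfolding f_def g_def inj_def by presburger+
  have "environment b s \<circ> f = environment c s" "environment b s \<circ> g = environment d s" for s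
    by (auto simp: environment_def f_def g_def b_def fun_eq_iff elim!: oddE) (rule FalseE, presburger)+
  then have "P s \<and> Q s \<longleftrightarrow> holds (PAnd (relabel f p) (relabel g q)) (environment b s)" for s
    by (simp add: holds_relabel inj P Q)
  then show ?thesis by (rule definableI)
qed

text \<open>The premise puts the bound variable at index 0 and shifts the others, so that backward
  application yields again a predicate of a single environment, ready for the next rule.\<close>

lemma definable_ex:
  assumes "definable (\<lambda>s. P (s 0) (\<lambda>n. s (Suc n)))"
  shows "definable (\<lambda>s. \<exists>x. is_set x \<and> P x s)"
proof -
  from assms obtain p c
    where P: "\<And>s. P (s 0) (\<lambda>n. s (Suc n)) \<longleftrightarrow> holds p (environment c s)"
    unfolding definable_def by blast
  \<comment> \<open>The bound variable needs a position that can be overwritten without disturbing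
    \<open>s\<close>. Moving all parameters up by one slot frees position 1 for it, and the
    remaining variables move down. The value \<open>b 0\<close> is always overwritten, hence
    arbitrary.\<close>
  define f where "f n = (if n = 0 then 1 else if even n then n - 2 else n + 2)" for n :: nat
  define b where "b n = c (n - 1)" for n
  have inj: "inj f"
    unfolding f_def inj_def by presburger
  have "(environment b s)(1 := x) \<circ> f = environment c (case_nat x s)" for s x
    by (auto simp: environment_def f_def b_def fun_eq_iff elim!: evenE oddE split: nat.split)
  then have "(\<exists>x. is_set x \<and> P x s) \<longleftrightarrow> holds (PExSet 1 (relabel f p)) (environment b s)" for s
    using P[of "case_nat _ s"] by (simp add: holds_relabel inj)
  then show ?thesis by (rule definableI)
qed

lemma definable_reindex:
  assumes "definable P" and "inj g"
  shows "definable (\<lambda>s. P (\<lambda>n. s (g n)))"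
proof -
  from assms obtain p c
    where P: "\<And>s. P s \<longleftrightarrow> holds p (environment c s)"
    unfolding definable_def by blast
  define f where "f n = (if even n then 2 * g (n div 2) else n)" for n
  have inj: "inj f"
  proof (rule injI)
    fix m n assume eq: "f m = f n"
    have "even (f k) \<longleftrightarrow> even k" for k by (simp add: f_def)
    with eq have "even m \<longleftrightarrow> even n" by metis
    with eq show "m = n"
      using injD[OF assms(2), of "m div 2" "n div 2"] by (cases "even m") (auto simp: f_def)
  qed
  have "environment c s \<circ> f = environment c (\<lambda>n. s (g n))" for s
    by (auto simp: environment_def f_def fun_eq_iff)
  then have "P (\<lambda>n. s (g n)) \<longleftrightarrow> holds (relabel f p) (environment c s)" for s
    by (simp add: holds_relabel inj P)
  then show ?thesis by (rule definableI)
qed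

lemma definable_disj:
  assumes "definable P" "definable Q"
  shows "definable (\<lambda>s. P s \<or> Q s)"
  using definable_neg[OF definable_conj[OF assms[THEN definable_neg]]] by simp

lemma definable_imp:
  assumes "definable P" "definable Q"
  shows "definable (\<lambda>s. P s \<longrightarrow> Q s)"
  using definable_disj[OF definable_neg[OF assms(1)] assms(2)] by (simp only: imp_conv_disj)

lemma definable_iff:
  assumes "definable P" "definable Q"
  shows "definable (\<lambda>s. P s \<longleftrightarrow> Q s)"
  using definable_conj[OF definable_imp[OF assms] definable_imp[OF assms(2,1)]]
  by (simp only: iff_conv_conj_imp)

lemma definable_all:
  assumes "definable (\<lambda>s. P (s 0) (\<lambda>n. s (Suc n)))"
  shows "definable (\<lambda>s. \<forall>x. is_set x \<longrightarrow> P x s)"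
  using definable_neg[OF definable_ex[OF definable_neg[OF assms]]] by simp

text \<open>
  A class term is definable when membership of a set in it is.  By extensionality this suffices
  for its use on either side of a membership or an equation.
\<close>

definition definable_term :: "((nat \<Rightarrow> 'c::membership) \<Rightarrow> 'c) \<Rightarrow> bool" where
  "definable_term t \<longleftrightarrow> definable (\<lambda>s. s 0 \<in>\<^sub>c t (\<lambda>n. s (Suc n)))"

lemma definable_term_var: "definable_term (\<lambda>s. s i)"
  unfolding definable_term_def
  by (rule definableI[where p = "PMem 0 (2 * Suc i)"]) (simp add: environment_def)

lemma definable_term_const: "definable_term (\<lambda>s. a)"
  unfolding definable_term_def
  by (rule definableI[where p = "PMem 0 1" and c = "\<lambda>_. a"]) (simp add: environment_def)

lemma definable_term_lift:
  assumes "definable_term t"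
  shows "definable_term (\<lambda>s. t (\<lambda>n. s (Suc n)))"
proof -
  \<comment> \<open>Index 0 is the element whose membership is tested and stays; index 1 is skipped
    to make room for the new bound variable.\<close>
  have "inj (case_nat 0 (\<lambda>n. Suc (Suc n)))"
    by (auto simp: inj_def split: nat.splits)
  from definable_reindex[OF assms[unfolded definable_term_def] this] show ?thesis
    unfolding definable_term_def by simp
qed

lemma is_setI: "x \<in>\<^sub>c y \<Longrightarrow> is_set x"
  unfolding is_set_def by blast

lemma definable_eq:
  fixes t u :: "(nat \<Rightarrow> 'c::gb_without_infinity) \<Rightarrow> 'c"
  assumes "definable_term t" "definable_term u"
  shows "definable (\<lambda>s. t s = u s)"
proof -
  have "(\<lambda>s. t s = u s) = (\<lambda>s. \<forall>\<^sub>s w. w \<in>\<^sub>c t s \<longleftrightarrow> w \<in>\<^sub>c u s)"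
    by (auto simp: fun_eq_iff intro: is_setI extensionality)
  moreover have "definable (\<lambda>s. \<forall>\<^sub>s w. w \<in>\<^sub>c t s \<longleftrightarrow> w \<in>\<^sub>c u s)"
    using assms unfolding definable_term_def by (intro definable_all definable_iff)
  ultimately show ?thesis by simp
qed

lemma definable_mem:
  fixes t u :: "(nat \<Rightarrow> 'c::gb_without_infinity) \<Rightarrow> 'c"
  assumes "definable_term t" "definable_term u"
  shows "definable (\<lambda>s. t s \<in>\<^sub>c u s)"
proof -
  have "(\<lambda>s. t s \<in>\<^sub>c u s) = (\<lambda>s. \<exists>\<^sub>s z. z = t s \<and> z \<in>\<^sub>c u s)"
    by (auto simp: fun_eq_iff intro: is_setI)
  moreover have "definable (\<lambda>s. \<exists>\<^sub>s z. z = t s \<and> z \<in>\<^sub>c u s)"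
    using assms(2) unfolding definable_term_def
    by (intro definable_ex definable_conj definable_eq definable_term_var
        definable_term_lift[OF assms(1)])
  ultimately show ?thesis by simp
qed

lemma definable_is_set:
  fixes t :: "(nat \<Rightarrow> 'c::gb_without_infinity) \<Rightarrow> 'c"
  assumes "definable_term t"
  shows "definable (\<lambda>s. is_set (t s))"
proof -
  have "(\<lambda>s. is_set (t s)) = (\<lambda>s. \<exists>\<^sub>s z. z = t s)" by simp
  moreover have "definable (\<lambda>s. \<exists>\<^sub>s z. z = t s)"
    by (intro definable_ex definable_eq definable_term_var definable_term_lift assms)
  ultimately show ?thesis by simp
qed

text \<open>No code has to express the content of \<open>P\<close>: without dependence on the
  environment it is either true or false, and both constants are definable.\<close>

lemma definable_const: "definable (\<lambda>s. P)"
proof -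
  have "definable (\<lambda>s::nat \<Rightarrow> 'a. s 0 = s 0)"
    by (rule definableI[where p = "PEq 0 0"]) simp
  from definable_neg[OF this] this show ?thesis by (cases P) simp_all
qed

lemmas definable_intros =
  definable_neg definable_conj definable_disj definable_imp definable_iff definable_ex
  definable_all definable_eq definable_mem definable_is_set definable_const definable_term_var
  definable_term_const

section \<open>Comprehension for definable predicates\<close>

lemma class_comprehension:
  fixes P :: "'c::gb_without_infinity \<Rightarrow> bool"
  assumes "definable (\<lambda>s. P (s 0))"
  obtains X where "\<And>x. x \<in>\<^sub>c X \<longleftrightarrow> is_set x \<and> P x"
proof -
  from assms obtain p c where P: "\<And>s. P (s 0) \<longleftrightarrow> holds p (environment c s)"
    unfolding definable_def by blast
  have eq: "(environment c undefined)(0 := x) = environment c (undefined(0 := x))" for x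
    by (auto simp: environment_def fun_eq_iff)
  from comprehension[where i = 0 and p = p and s = "environment c undefined"]
  obtain X where "\<And>x. x \<in>\<^sub>c X \<longleftrightarrow> is_set x \<and> holds p ((environment c undefined)(0 := x))"
    by blast
  then show thesis
    using that[of X] P[of "undefined(0 := _)"] by (simp add: eq)
qed

text \<open>Access to all classes introduced by \<open>THE\<close>: comprehension gives existence,
  extensionality uniqueness. The second premise removes the sethood guard that comprehension
  adds.\<close>

lemma the_class:
  fixes P :: "'c::gb_without_infinity \<Rightarrow> bool"
  assumes "definable (\<lambda>s. P (s 0))" and "\<And>x. P x \<Longrightarrow> is_set x"
  shows "x \<in>\<^sub>c (THE X. \<forall>x. x \<in>\<^sub>c X \<longleftrightarrow> P x) \<longleftrightarrow> P x"
proof -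
  from class_comprehension[OF assms(1)] obtain X where X: "\<And>x. x \<in>\<^sub>c X \<longleftrightarrow> P x"
    using assms(2) by metis
  then have "(THE X. \<forall>x. x \<in>\<^sub>c X \<longleftrightarrow> P x) = X"
    by (intro the_equality) (auto intro: extensionality)
  with X show ?thesis by simp
qed

section \<open>Sets, pairs and functions\<close>

lemma mem_upair: "z \<in>\<^sub>c upair a b \<longleftrightarrow> is_set z \<and> (z = a \<or> z = b)"
  for a :: "'c::gb_without_infinity"
  unfolding upair_def
  by (rule the_class[where P = "\<lambda>z. is_set z \<and> (z = a \<or> z = b)"]) (intro definable_intros, simp)

lemma mem_singleton: "z \<in>\<^sub>c singleton a \<longleftrightarrow> is_set z \<and> z = a"
  by (simp add: singleton_def mem_upair)

lemma mem_empty [simp]: "\<not> z \<in>\<^sub>c empty_class"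
proof -
  have "z \<in>\<^sub>c (THE e. \<forall>z. z \<in>\<^sub>c e \<longleftrightarrow> False) \<longleftrightarrow> False"
    by (rule the_class[where P = "\<lambda>_. False"]) (intro definable_intros, simp)
  then show ?thesis unfolding empty_class_def by simp
qed

lemma mem_successor: "z \<in>\<^sub>c successor n \<longleftrightarrow> z \<in>\<^sub>c n \<or> is_set z \<and> z = n"
  unfolding successor_def
  by (rule the_class[where P = "\<lambda>z. z \<in>\<^sub>c n \<or> is_set z \<and> z = n"])
    (intro definable_intros, auto intro: is_setI)

lemma definable_term_upair:
  fixes t u :: "(nat \<Rightarrow> 'c::gb_without_infinity) \<Rightarrow> 'c"
  assumes "definable_term t" "definable_term u"
  shows "definable_term (\<lambda>s. upair (t s) (u s))"
  unfolding definable_term_def mem_upair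
  by (intro definable_intros assms[THEN definable_term_lift])

lemma definable_term_opair:
  fixes t u :: "(nat \<Rightarrow> 'c::gb_without_infinity) \<Rightarrow> 'c"
  assumes "definable_term t" "definable_term u"
  shows "definable_term (\<lambda>s. opair (t s) (u s))"
  unfolding opair_def by (intro definable_term_upair assms)

lemma definable_maps:
  fixes t u v :: "(nat \<Rightarrow> 'c::gb_without_infinity) \<Rightarrow> 'c"
  assumes "definable_term t" "definable_term u" "definable_term v"
  shows "definable (\<lambda>s. maps (t s) (u s) (v s))"
  unfolding maps_def by (intro definable_intros definable_term_opair assms)

lemma maps_sets: "maps f x y \<Longrightarrow> is_set x" "maps f x y \<Longrightarrow> is_set y"
  by (simp_all add: maps_def)

lemma is_set_empty: "is_set (empty_class :: 'c::gb_without_infinity)"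
proof -
  obtain a :: 'c where "is_set a" using set_existence by blast
  \<comment> \<open>\<open>set_existence\<close> provides some set without saying which; its image
    under the empty function is the empty set.\<close>
  have "\<forall>x y y'. maps empty_class x y \<and> maps empty_class x y' \<longrightarrow> y = y'"
    by (simp add: maps_def)
  from replacement[OF this \<open>is_set a\<close>] obtain b :: 'c
    where "is_set b" "\<And>y. \<not> y \<in>\<^sub>c b"
    by (auto simp: maps_def)
  moreover from this(2) have "b = empty_class" by (intro extensionality) simp
  ultimately show ?thesis by simp
qed

text \<open>Arguments that are proper classes drop out, and the pair degenerates to a singleton or
  to the empty class, which are sets as well. Thus every ordered pair, and with it everything built
  by the expression constructors, is a set without side conditions.\<close>

lemma is_set_upair [simp]: "is_set (upair a b)" for a b :: "'c::gb_without_infinity"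
proof -
  have sets: "is_set (upair a b)" if "is_set a" "is_set b" for a b :: 'c
    using pairing[OF that] that by (metis extensionality mem_upair)
  consider "is_set a" "is_set b" | "is_set a" "\<not> is_set b" | "\<not> is_set a" "is_set b"
    | "\<not> is_set a" "\<not> is_set b" by blast
  then show ?thesis
  proof cases
    case 2
    then have "upair a b = upair a a" by (intro extensionality) (auto simp: mem_upair)
    with 2 show ?thesis by (simp add: sets)
  next
    case 3
    then have "upair a b = upair b b" by (intro extensionality) (auto simp: mem_upair)
    with 3 show ?thesis by (simp add: sets)
  next
    case 4
    then have "upair a b = empty_class" by (intro extensionality) (auto simp: mem_upair)
    then show ?thesis by (simp add: is_set_empty)
  qed (simp add: sets)
qed

lemma is_set_opair [simp]: "is_set (opair a b)" for a b :: "'c::gb_without_infinity"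
  by (simp add: opair_def)

lemma upair_inject:
  fixes a b c d :: "'c::gb_without_infinity"
  assumes "is_set a" "is_set b" "is_set c" "is_set d"
  shows "upair a b = upair c d \<longleftrightarrow> a = c \<and> b = d \<or> a = d \<and> b = c"
proof
  assume eq: "upair a b = upair c d"
  have "z = a \<or> z = b \<longleftrightarrow> z = c \<or> z = d" if "is_set z" for z
    using mem_upair[of z a b] mem_upair[of z c d] eq that by simp
  with assms show "a = c \<and> b = d \<or> a = d \<and> b = c" by metis
next
  assume "a = c \<and> b = d \<or> a = d \<and> b = c"
  then show "upair a b = upair c d"
    by (intro extensionality) (auto simp: mem_upair)
qed

lemma opair_inject [simp]:
  fixes a b c d :: "'c::gb_without_infinity"
  assumes "is_set a" "is_set b" "is_set c" "is_set d"
  shows "opair a b = opair c d \<longleftrightarrow> a = c \<and> b = d"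
  using assms by (auto simp: opair_def upair_inject)

text \<open>Separation obtained from replacement: \<open>X\<close> is the image of \<open>a\<close>
  under the identity restricted to \<open>X\<close>.\<close>

lemma subset_is_set:
  fixes X :: "'c::gb_without_infinity"
  assumes "is_set a" and "\<And>x. x \<in>\<^sub>c X \<Longrightarrow> x \<in>\<^sub>c a"
  shows "is_set X"
proof -
  have "definable (\<lambda>s. \<exists>\<^sub>s x. x \<in>\<^sub>c X \<and> s 0 = opair x x)"
    by (intro definable_intros definable_term_opair)
  then obtain f where f: "\<And>z. z \<in>\<^sub>c f \<longleftrightarrow> is_set z \<and> (\<exists>\<^sub>s x. x \<in>\<^sub>c X \<and> z = opair x x)"
    by (rule class_comprehension) (rule that)
  have maps: "maps f x y \<longleftrightarrow> x \<in>\<^sub>c X \<and> y = x" for x y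
    by (auto simp: maps_def f intro: is_setI)
  then have "\<forall>x y y'. maps f x y \<and> maps f x y' \<longrightarrow> y = y'" by simp
  from replacement[OF this assms(1)] obtain b
    where "is_set b" and b: "\<And>y. y \<in>\<^sub>c b \<longleftrightarrow> (\<exists>x. x \<in>\<^sub>c a \<and> maps f x y)"
    by blast
  moreover have "b = X"
    by (rule extensionality) (auto simp: b maps assms(2))
  ultimately show ?thesis by simp
qed

lemma singleton_is_set [simp]: "is_set (singleton a)"
  by (simp add: singleton_def)

lemma binary_union:
  fixes a b :: "'c::gb_without_infinity"
  assumes "is_set a" "is_set b"
  obtains u where "is_set u" "\<And>z. z \<in>\<^sub>c u \<longleftrightarrow> z \<in>\<^sub>c a \<or> z \<in>\<^sub>c b"
proof -
  from union[OF is_set_upair[of a b]] obtain u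
    where u: "is_set u" "\<And>z. z \<in>\<^sub>c u \<longleftrightarrow> (\<exists>y. z \<in>\<^sub>c y \<and> y \<in>\<^sub>c upair a b)" by blast
  show thesis by (rule that[OF u(1)]) (use assms in \<open>auto simp: u(2) mem_upair\<close>)
qed

lemma mem_update:
  fixes A :: "'c::gb_without_infinity"
  shows "z \<in>\<^sub>c update A v x \<longleftrightarrow> z \<in>\<^sub>c A \<and> \<not> (\<exists>\<^sub>s y. z = opair v y) \<or> z = opair v x"
  unfolding update_def
proof (rule the_class[where P = "\<lambda>z. z \<in>\<^sub>c A \<and> \<not> (\<exists>\<^sub>s y. z = opair v y) \<or> z = opair v x"])
  show "definable (\<lambda>s. s 0 \<in>\<^sub>c A \<and> \<not> (\<exists>\<^sub>s y. s 0 = opair v y) \<or> s 0 = opair v x)"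
    by (intro definable_intros definable_term_opair)
qed (auto dest: is_setI)

lemma update_is_set:
  assumes "is_set A"
  shows "is_set (update A v x)"
proof -
  obtain u where u: "is_set u" "\<And>z. z \<in>\<^sub>c u \<longleftrightarrow> z \<in>\<^sub>c A \<or> z \<in>\<^sub>c singleton (opair v x)"
    using binary_union[OF assms singleton_is_set] by blast
  show ?thesis by (rule subset_is_set[OF u(1)]) (auto simp: u(2) mem_update mem_singleton)
qed

lemma definable_term_update:
  fixes t u v :: "(nat \<Rightarrow> 'c::gb_without_infinity) \<Rightarrow> 'c"
  assumes "definable_term t" "definable_term u" "definable_term v"
  shows "definable_term (\<lambda>s. update (t s) (u s) (v s))"
  unfolding definable_term_def mem_update
  by (intro definable_intros definable_term_opair assms[THEN definable_term_lift]
      assms[THEN definable_term_lift, THEN definable_term_lift])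

section \<open>Natural numbers and expressions\<close>

lemma not_mem_self: "\<not> x \<in>\<^sub>c x" for x :: "'c::gb_without_infinity"
proof
  assume "x \<in>\<^sub>c x"
  moreover from this have "x \<in>\<^sub>c singleton x" by (auto simp: mem_singleton is_setI)
  ultimately show False
    using foundation[of "singleton x"] by (auto simp: mem_singleton)
qed

lemma successor_is_set:
  assumes "is_set n"
  shows "is_set (successor n)"
proof -
  obtain u where u: "is_set u" "\<And>z. z \<in>\<^sub>c u \<longleftrightarrow> z \<in>\<^sub>c n \<or> z \<in>\<^sub>c singleton n"
    using binary_union[OF assms singleton_is_set] by blast
  show ?thesis by (rule subset_is_set[OF u(1)]) (auto simp: u(2) mem_successor mem_singleton)
qed

lemma num_is_set [simp]: "is_set (num k)"
  by (induction k) (simp_all add: is_set_empty successor_is_set)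

lemma mem_num: "z \<in>\<^sub>c num k \<longleftrightarrow> (\<exists>m<k. z = num m)"
  by (induction k) (auto simp: mem_successor less_Suc_eq)

declare num.simps [simp del]

text \<open>The smaller of two numerals is an element of the larger, so equality would produce a
  self-membership. This makes the tags of the expression constructors, and the two truth values,
  distinct.\<close>

lemma num_eq_iff [simp]: "num m = num n \<longleftrightarrow> m = n"
  by (metis linorder_neqE_nat mem_num not_mem_self)

lemmas constructor_defs =
  Var_def FunApp_def Equal_def RelApp_def Neg_def Or_def And_def Imp_def Iff_def ExQ_def AllQ_def

lemma natural_is_set: "is_natural n \<Longrightarrow> is_set n"
  by (simp add: is_natural_def)

lemma var_is_set: "is_var v \<Longrightarrow> is_set v"
  by (auto simp: is_var_def Var_def)

lemma natural_trans: "is_natural n \<Longrightarrow> i \<in>\<^sub>c n \<Longrightarrow> m \<in>\<^sub>c i \<Longrightarrow> m \<in>\<^sub>c n"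
  unfolding is_natural_def is_transitive_def by blast

lemma is_natural_mem:
  assumes "is_natural n" "i \<in>\<^sub>c n"
  shows "is_natural i"
  unfolding is_natural_def
proof (intro conjI allI impI)
  show "is_set i" using assms(2) by (rule is_setI)
  show "is_transitive i" using assms by (simp add: is_natural_def)
  show "is_transitive m" if "m \<in>\<^sub>c i" for m
    using natural_trans[OF assms that] assms(1) by (simp add: is_natural_def)
  show "m = empty_class \<or> (\<exists>k. k \<in>\<^sub>c m \<and> m = successor k)" if "m = i \<or> m \<in>\<^sub>c i" for m
  proof -
    have "m \<in>\<^sub>c n" using natural_trans[OF assms] assms(2) that by blast
    with assms(1) show ?thesis unfolding is_natural_def by blast
  qed
qed

lemma successor_natural:
  assumes n: "is_natural n"
  shows "is_natural (successor n)"
  unfolding is_natural_def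
proof (intro conjI allI impI)
  have set: "is_set n" using n by (rule natural_is_set)
  show "is_set (successor n)" using set by (rule successor_is_set)
  show "is_transitive (successor n)"
    using natural_trans[OF n] unfolding is_transitive_def mem_successor by blast
  show "is_transitive m" if "m \<in>\<^sub>c successor n" for m
    using that n by (auto simp: mem_successor is_natural_def)
  show "m = empty_class \<or> (\<exists>k. k \<in>\<^sub>c m \<and> m = successor k)"
    if "m = successor n \<or> m \<in>\<^sub>c successor n" for m
  proof (cases "m = successor n")
    case True
    moreover have "n \<in>\<^sub>c successor n" using set by (simp add: mem_successor)
    ultimately show ?thesis by blast
  next
    case False
    with that have "m = n \<or> m \<in>\<^sub>c n" by (auto simp: mem_successor)
    with n show ?thesis unfolding is_natural_def by blast
  qed
qed

section \<open>Immediate subexpressions and formation sequences\<close>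

lemma immediate_sub_simps [simp]:
  fixes b :: "'c::gb_without_infinity"
  shows "is_var v \<Longrightarrow> \<not> immediate_sub b v"
    and "is_set f \<Longrightarrow> is_set a \<Longrightarrow> immediate_sub b (FunApp f a) \<longleftrightarrow> (\<exists>i. maps a i b)"
    and "is_set f \<Longrightarrow> is_set a \<Longrightarrow> immediate_sub b (RelApp f a) \<longleftrightarrow> (\<exists>i. maps a i b)"
    and "is_set t \<Longrightarrow> is_set u \<Longrightarrow> immediate_sub b (Equal t u) \<longleftrightarrow> b = t \<or> b = u"
    and "is_set p \<Longrightarrow> immediate_sub b (Neg p) \<longleftrightarrow> b = p"
    and "is_set p \<Longrightarrow> is_set q \<Longrightarrow> immediate_sub b (Or p q) \<longleftrightarrow> b = p \<or> b = q"
    and "is_set p \<Longrightarrow> is_set q \<Longrightarrow> immediate_sub b (And p q) \<longleftrightarrow> b = p \<or> b = q"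
    and "is_set p \<Longrightarrow> is_set q \<Longrightarrow> immediate_sub b (Imp p q) \<longleftrightarrow> b = p \<or> b = q"
    and "is_set p \<Longrightarrow> is_set q \<Longrightarrow> immediate_sub b (Iff p q) \<longleftrightarrow> b = p \<or> b = q"
    and "is_set v \<Longrightarrow> is_set p \<Longrightarrow> immediate_sub b (ExQ v p) \<longleftrightarrow> b = p"
    and "is_set v \<Longrightarrow> is_set p \<Longrightarrow> immediate_sub b (AllQ v p) \<longleftrightarrow> b = p"
  by (auto simp: immediate_sub_def constructor_defs is_var_def natural_is_set
      dest: maps_sets cong: conj_cong)

text \<open>Applied with \<open>P\<close> saying "occurs at an earlier index", this turns descent to
  an immediate subexpression into descent of indices in a formation sequence.\<close>

lemma immediate_sub_formation_step:
  fixes b :: "'c::gb_without_infinity"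
  assumes "formation_step \<rho> P e" and "\<And>c. P c \<Longrightarrow> is_set c" and "immediate_sub b e"
  shows "P b"
  using assms(1,3) unfolding formation_step_def Let_def
  by (auto simp: assms(2) is_tuple_def maps_sets var_is_set)

lemma is_tuple_D:
  assumes "is_tuple n P a"
  shows "is_natural n" "is_set a" "is_function a" "in_dom i a \<longleftrightarrow> i \<in>\<^sub>c n"
    "maps a i y \<Longrightarrow> i \<in>\<^sub>c n" "maps a i y \<Longrightarrow> P y"
  using assms by (auto simp: is_tuple_def in_dom_def)

lemma is_functionD: "is_function f \<Longrightarrow> maps f x y \<Longrightarrow> maps f x y' \<Longrightarrow> y = y'"
  by (auto simp: is_function_def)

text \<open>An entry of a formation sequence is the last entry of an initial segment.\<close>

lemma formation_sequence_entry:
  fixes s :: "'c::gb_without_infinity"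
  assumes s: "is_tuple (successor n) is_set s"
    and step: "\<And>i d. maps s i d \<Longrightarrow> formation_step \<rho> (\<lambda>c. \<exists>j. j \<in>\<^sub>c i \<and> maps s j c) d"
    and e: "maps s k e"
  shows "is_expression \<rho> e"
proof -
  have "definable (\<lambda>s'. s' 0 \<in>\<^sub>c s \<and> (\<exists>\<^sub>s i. i \<in>\<^sub>c successor k \<and> (\<exists>\<^sub>s d. s' 0 = opair i d)))"
    by (intro definable_intros definable_term_opair)
  then obtain r where r: "\<And>z. z \<in>\<^sub>c r \<longleftrightarrow> is_set z \<and> (z \<in>\<^sub>c s \<and>
      (\<exists>\<^sub>s i. i \<in>\<^sub>c successor k \<and> (\<exists>\<^sub>s d. z = opair i d)))"
    by (rule class_comprehension) (rule that)
  have maps: "maps r i d \<longleftrightarrow> maps s i d \<and> i \<in>\<^sub>c successor k" for i d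
    by (auto simp: maps_def r)
  have k: "k \<in>\<^sub>c successor n" "is_natural (successor n)"
    using is_tuple_D[OF s] e by blast+
  then have nat: "is_natural k" "is_natural (successor k)"
    using is_natural_mem successor_natural by blast+
  have trans: "i \<in>\<^sub>c successor n" if "i \<in>\<^sub>c successor k" for i
    using that k natural_trans[OF k(2,1)] unfolding mem_successor[of i k] by blast
  have "is_tuple (successor k) is_set r"
    unfolding is_tuple_def
  proof (intro conjI allI impI)
    show "is_set r"
      by (rule subset_is_set[of s]) (auto simp: r is_tuple_D[OF s])
    show "is_function r"
      unfolding is_function_def maps using is_tuple_D(3)[OF s] by (auto simp: is_function_def r)
    show "in_dom i r \<longleftrightarrow> i \<in>\<^sub>c successor k" for i
      unfolding in_dom_def maps using trans is_tuple_D(4)[OF s] by (auto simp: in_dom_def)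
  qed (auto simp: nat dest: maps_sets)
  moreover have "maps r k e"
    using e by (auto simp: maps mem_successor maps_sets)
  moreover have "formation_step \<rho> (\<lambda>c. \<exists>j. j \<in>\<^sub>c i \<and> maps r j c) d" if "maps r i d" for i d
  proof -
    have i: "i \<in>\<^sub>c successor k" "maps s i d" using that by (simp_all add: maps)
    then have "j \<in>\<^sub>c successor k" if "j \<in>\<^sub>c i" for j
      using natural_trans[OF nat(2)] that by blast
    then have "(\<lambda>c. \<exists>j. j \<in>\<^sub>c i \<and> maps r j c) = (\<lambda>c. \<exists>j. j \<in>\<^sub>c i \<and> maps s j c)"
      by (auto simp: maps fun_eq_iff)
    with step[OF i(2)] show ?thesis by simp
  qed
  ultimately show ?thesis unfolding is_expression_def using nat(1) by blast
qed

section \<open>Definability of assignments\<close>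

text \<open>The definitions often quantify over all classes where a membership or a
  \<open>maps\<close> already forces the witness to be a set. Such quantifiers can be replaced by
  set quantifiers, the only ones that predicative comprehension admits.\<close>

lemma definable_ex_set:
  assumes "\<And>x s. P x s \<Longrightarrow> is_set x" and "definable (\<lambda>s. P (s 0) (\<lambda>n. s (Suc n)))"
  shows "definable (\<lambda>s. \<exists>x. P x s)"
proof -
  have "(\<lambda>s. \<exists>x. P x s) = (\<lambda>s. \<exists>\<^sub>s x. P x s)" using assms(1) by blast
  with definable_ex[OF assms(2)] show ?thesis by simp
qed

lemma definable_all_set:
  assumes "\<And>x s. \<not> P x s \<Longrightarrow> is_set x" and "definable (\<lambda>s. P (s 0) (\<lambda>n. s (Suc n)))"
  shows "definable (\<lambda>s. \<forall>x. P x s)"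
proof -
  have "(\<lambda>s. \<forall>x. P x s) = (\<lambda>s. \<forall>\<^sub>s x. P x s)" using assms(1) by blast
  with definable_all[OF assms(2)] show ?thesis by simp
qed

lemmas definable_set_intros =
  definable_intros definable_ex_set definable_all_set definable_term_opair definable_maps

lemma definable_term_successor:
  "definable_term (\<lambda>s. successor (s i :: 'c::gb_without_infinity))"
  unfolding definable_term_def mem_successor by (intro definable_intros)

lemma definable_is_transitive:
  "definable (\<lambda>s. is_transitive (s i :: 'c::gb_without_infinity))"
  unfolding is_transitive_def by (intro definable_set_intros) (auto dest: is_setI)

lemma definable_in_dom:
  "definable (\<lambda>s. in_dom (s i) (s j :: 'c::gb_without_infinity))"
  unfolding in_dom_def by (intro definable_set_intros) (auto dest: maps_sets)

lemma definable_is_function: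
  "definable (\<lambda>s. is_function (s i :: 'c::gb_without_infinity))"
  unfolding is_function_def by (intro definable_set_intros) (auto dest: maps_sets is_setI)

lemma definable_is_natural:
  "definable (\<lambda>s. is_natural (s i :: 'c::gb_without_infinity))"
proof -
  \<comment> \<open>The guard \<open>m = n\<close> alone does not make \<open>m\<close> a set; only
    together with the conjunct \<open>is_set n\<close> can the last quantifier be restricted to
    sets.\<close>
  have eq: "is_natural n \<longleftrightarrow> is_set n \<and> is_transitive n \<and> (\<forall>m. m \<in>\<^sub>c n \<longrightarrow> is_transitive m) \<and>
     (\<forall>\<^sub>s m. m = n \<or> m \<in>\<^sub>c n \<longrightarrow> m = empty_class \<or> (\<exists>k. k \<in>\<^sub>c m \<and> m = successor k))" for n :: 'c
    unfolding is_natural_def by (blast dest: is_setI)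
  show ?thesis
    unfolding eq
    by (intro definable_set_intros definable_is_transitive definable_term_successor)
      (auto dest: is_setI)
qed

lemma definable_is_tuple:
  "definable (\<lambda>s. is_tuple (s i) (\<lambda>y. y \<in>\<^sub>c (s j :: 'c::gb_without_infinity)) (s k))"
  unfolding is_tuple_def
  by (intro definable_set_intros definable_is_natural definable_is_function definable_in_dom)
    (auto simp: in_dom_def dest: maps_sets is_setI)

lemma definable_is_finite:
  "definable (\<lambda>s. is_finite (s i :: 'c::gb_without_infinity))"
  unfolding is_finite_def
  by (intro definable_set_intros definable_is_tuple)
    (auto dest: maps_sets is_setI is_tuple_D natural_is_set)

lemma definable_is_var:
  "definable (\<lambda>s. is_var (s i :: 'c::gb_without_infinity))"
  unfolding is_var_def Var_def
  by (intro definable_set_intros definable_is_natural) (auto dest: natural_is_set)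

lemma definable_immediate_sub:
  "definable (\<lambda>s. immediate_sub (s i) (s j :: 'c::gb_without_infinity))"
  unfolding immediate_sub_def constructor_defs
  by (intro definable_set_intros) (auto dest: maps_sets)

lemma definable_binds:
  "definable (\<lambda>s. binds (s i) (s j :: 'c::gb_without_infinity))"
  unfolding binds_def constructor_defs by (intro definable_set_intros)

lemma definable_free_in:
  "definable (\<lambda>s. free_in (s i) (e :: 'c::gb_without_infinity))"
  unfolding free_in_def
  by (intro definable_set_intros definable_is_var definable_immediate_sub definable_binds)
    (auto dest: is_setI simp: immediate_sub_def)

lemma definable_is_assignment:
  "definable (\<lambda>s. is_assignment \<SS> e (s i :: 'c::gb_without_infinity))"
  unfolding is_assignment_def
  by (intro definable_set_intros definable_is_finite definable_is_function definable_free_in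
      definable_in_dom)
    (auto simp: free_in_def dest: maps_sets var_is_set)

section \<open>Tarskian clauses\<close>

text \<open>The right-hand side of the Tarskian clauses, separated because it refers to
  \<open>F\<close> at immediate subexpressions of \<open>e\<close> only. It can therefore be
  evaluated before \<open>F\<close> has a value at \<open>e\<close>.\<close>

definition term_clause ::
    "'c::gb_without_infinity class_structure \<Rightarrow> 'c \<Rightarrow> 'c \<Rightarrow> 'c \<Rightarrow> 'c \<Rightarrow> bool" where
  "term_clause \<SS> F e A x \<longleftrightarrow>
     (is_var e \<longrightarrow> maps A e x) \<and>
     (\<forall>\<^sub>s f. \<forall>\<^sub>s a. e = FunApp f a \<longrightarrow>
        (\<exists>b. value_tuple F A a b \<and> maps (fun_interp \<SS>) (opair f b) x))"

definition truth_clause ::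
    "'c::gb_without_infinity class_structure \<Rightarrow> 'c \<Rightarrow> 'c \<Rightarrow> 'c \<Rightarrow> bool" where
  "truth_clause \<SS> F e A \<longleftrightarrow>
     (\<forall>\<^sub>s t. \<forall>\<^sub>s u. e = Equal t u \<longrightarrow> (\<exists>x. val F t A x \<and> val F u A x)) \<and>
     (\<forall>\<^sub>s r. \<forall>\<^sub>s a. e = RelApp r a \<longrightarrow> (\<exists>b. value_tuple F A a b \<and> opair r b \<in>\<^sub>c rel_interp \<SS>)) \<and>
     (\<forall>\<^sub>s p. e = Neg p \<longrightarrow> \<not> true_at F p A) \<and>
     (\<forall>\<^sub>s p. \<forall>\<^sub>s q. e = Or p q \<longrightarrow> true_at F p A \<or> true_at F q A) \<and>
     (\<forall>\<^sub>s p. \<forall>\<^sub>s q. e = And p q \<longrightarrow> true_at F p A \<and> true_at F q A) \<and>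
     (\<forall>\<^sub>s p. \<forall>\<^sub>s q. e = Imp p q \<longrightarrow> (true_at F p A \<longrightarrow> true_at F q A)) \<and>
     (\<forall>\<^sub>s p. \<forall>\<^sub>s q. e = Iff p q \<longrightarrow> (true_at F p A \<longleftrightarrow> true_at F q A)) \<and>
     (\<forall>\<^sub>s v. \<forall>\<^sub>s p. e = ExQ v p \<longrightarrow> (\<exists>x. x \<in>\<^sub>c universe \<SS> \<and> true_at F p (update A v x))) \<and>
     (\<forall>\<^sub>s v. \<forall>\<^sub>s p. e = AllQ v p \<longrightarrow> (\<forall>x. x \<in>\<^sub>c universe \<SS> \<longrightarrow> true_at F p (update A v x)))"

text \<open>Stronger than the negation of \<open>term_shaped\<close>, since a class that is no
  expression may be neither. It guarantees that one of the clauses for formulas applies.\<close>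

definition formula_shaped :: "'c::gb_without_infinity \<Rightarrow> bool" where
  "formula_shaped e \<longleftrightarrow>
     (\<exists>\<^sub>s p. e = Neg p) \<or>
     (\<exists>\<^sub>s p. \<exists>\<^sub>s q. e = Equal p q \<or> e = RelApp p q \<or> e = Or p q \<or> e = And p q \<or> e = Imp p q \<or>
        e = Iff p q \<or> e = ExQ p q \<or> e = AllQ p q)"

lemma shape_simps [simp]:
  fixes p q :: "'c::gb_without_infinity"
  shows "is_var p \<Longrightarrow> term_shaped p"
    and "is_set p \<Longrightarrow> is_set q \<Longrightarrow> term_shaped (FunApp p q)"
    and "is_set p \<Longrightarrow> formula_shaped (Neg p)"
    and "is_set p \<Longrightarrow> is_set q \<Longrightarrow> formula_shaped (Equal p q)"
    and "is_set p \<Longrightarrow> is_set q \<Longrightarrow> formula_shaped (RelApp p q)"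
    and "is_set p \<Longrightarrow> is_set q \<Longrightarrow> formula_shaped (Or p q)"
    and "is_set p \<Longrightarrow> is_set q \<Longrightarrow> formula_shaped (And p q)"
    and "is_set p \<Longrightarrow> is_set q \<Longrightarrow> formula_shaped (Imp p q)"
    and "is_set p \<Longrightarrow> is_set q \<Longrightarrow> formula_shaped (Iff p q)"
    and "is_set p \<Longrightarrow> is_set q \<Longrightarrow> formula_shaped (ExQ p q)"
    and "is_set p \<Longrightarrow> is_set q \<Longrightarrow> formula_shaped (AllQ p q)"
  unfolding term_shaped_def formula_shaped_def by blast+

lemma formula_not_term_shaped: "formula_shaped e \<Longrightarrow> \<not> term_shaped e"
  by (auto simp: formula_shaped_def term_shaped_def is_var_def constructor_defs natural_is_set)

lemma tarskian_at_term:
  assumes "term_shaped e"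
  shows "tarskian_at \<SS> F e A \<longleftrightarrow> (\<forall>x. val F e A x \<longleftrightarrow> term_clause \<SS> F e A x)"
  using assms unfolding term_shaped_def
  by (auto simp: tarskian_at_def term_clause_def is_var_def constructor_defs natural_is_set)

lemma tarskian_at_formula:
  assumes "formula_shaped e"
  shows "tarskian_at \<SS> F e A \<longleftrightarrow> (true_at F e A \<longleftrightarrow> truth_clause \<SS> F e A)"
  using assms unfolding formula_shaped_def
  by (elim exE disjE conjE; simp add: tarskian_at_def truth_clause_def is_var_def constructor_defs
      natural_is_set cong: conj_cong)

lemma expression_shape:
  assumes "is_expression \<rho> e"
  shows "is_set e" and "term_shaped e \<or> formula_shaped e"
proof -
  from assms obtain s n where "maps s n e"
    and "\<forall>i d. maps s i d \<longrightarrow> formation_step \<rho> (\<lambda>c. \<exists>j. j \<in>\<^sub>c i \<and> maps s j c) d"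
    unfolding is_expression_def by blast
  then have step: "formation_step \<rho> (\<lambda>c. \<exists>j. j \<in>\<^sub>c n \<and> maps s j c) e" and "is_set e"
    by (auto dest: maps_sets)
  then show "is_set e" by simp
  from step show "term_shaped e \<or> formula_shaped e"
    unfolding formation_step_def Let_def
  proof (elim disjE exE conjE)
    fix f n a P assume "maps (fun_arity \<rho>) f n" "is_tuple n P a" "e = FunApp f a"
    then show ?thesis by (simp add: maps_sets is_tuple_D(2))
  next
    fix f n a P assume "maps (rel_arity \<rho>) f n" "is_tuple n P a" "e = RelApp f a"
    then show ?thesis by (simp add: maps_sets is_tuple_D(2))
  qed (simp_all add: maps_sets var_is_set)
qed

context
  fixes F G e A :: "'c::gb_without_infinity"
  assumes A: "is_set A"
    and eq: "\<And>b B y. immediate_sub b e \<Longrightarrow> is_set B \<Longrightarrow> val F b B y \<longleftrightarrow> val G b B y"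
begin

lemma value_tuple_cong:
  assumes "is_set f" "is_set a" "e = FunApp f a \<or> e = RelApp f a"
  shows "value_tuple F A a b \<longleftrightarrow> value_tuple G A a b"
proof -
  have "val F t A x \<longleftrightarrow> val G t A x" if "maps a i t" for i t x
    using that assms by (intro eq A) auto
  then show ?thesis unfolding value_tuple_def by blast
qed

lemma term_clause_cong: "term_clause \<SS> F e A x \<longleftrightarrow> term_clause \<SS> G e A x"
  unfolding term_clause_def using value_tuple_cong by blast

text \<open>Agreement at immediate subexpressions is assumed for every set \<open>B\<close>, not
  just for \<open>A\<close>, because the quantifier clauses look at updates of
  \<open>A\<close>.\<close>

lemma truth_clause_cong: "truth_clause \<SS> F e A \<longleftrightarrow> truth_clause \<SS> G e A"
proof -
  have true_eq: "true_at F b B \<longleftrightarrow> true_at G b B" if "immediate_sub b e" "is_set B" for b B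
    using eq[OF that] by (simp add: true_at_def)
  show ?thesis
    unfolding truth_clause_def
    by (intro conj_cong all_cong1 imp_cong refl)
      (auto simp: eq true_eq A update_is_set value_tuple_cong)
qed

end

section \<open>Induction on expressions and the subexpression relation\<close>

lemma expression_induct:
  fixes P :: "'c::gb_without_infinity \<Rightarrow> bool"
  assumes e: "is_expression \<rho> e"
    and def: "definable (\<lambda>s. P (s 0))"
    and step: "\<And>c. is_expression \<rho> c \<Longrightarrow> (\<And>b. immediate_sub b c \<Longrightarrow> P b) \<Longrightarrow> P c"
  shows "P e"
proof (rule ccontr)
  assume "\<not> P e"
  from e obtain s n where tuple: "is_tuple (successor n) is_set s" and "maps s n e"
    and formed: "\<And>i d. maps s i d \<Longrightarrow> formation_step \<rho> (\<lambda>c. \<exists>j. j \<in>\<^sub>c i \<and> maps s j c) d"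
    unfolding is_expression_def by blast
  \<comment> \<open>Foundation applies only to an existing class of failing indices; this is where
    definability of \<open>P\<close> enters. A minimal index is a least one because the earlier
    indices are its elements.\<close>
  have "definable (\<lambda>s'. \<exists>\<^sub>s d. maps s (s' 0) d \<and> \<not> P d)"
    by (intro definable_intros definable_maps def)
  then obtain X where X: "\<And>i. i \<in>\<^sub>c X \<longleftrightarrow> is_set i \<and> (\<exists>\<^sub>s d. maps s i d \<and> \<not> P d)"
    by (rule class_comprehension) (rule that)
  have "n \<in>\<^sub>c X"
    using \<open>maps s n e\<close> \<open>\<not> P e\<close> by (auto simp: X dest: maps_sets)
  then obtain i where "i \<in>\<^sub>c X" and minimal: "\<And>j. j \<in>\<^sub>c i \<Longrightarrow> \<not> j \<in>\<^sub>c X"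
    using foundation[of X] by blast
  then obtain d where d: "maps s i d" "\<not> P d" by (auto simp: X)
  have "P b" if "immediate_sub b d" for b
  proof -
    have "\<exists>j. j \<in>\<^sub>c i \<and> maps s j b"
      by (rule immediate_sub_formation_step[OF formed[OF d(1)] _ that]) (auto dest: maps_sets)
    then show ?thesis using minimal by (auto simp: X dest: maps_sets)
  qed
  with step formation_sequence_entry[OF tuple formed d(1)] d(2) show False by blast
qed

lemma subexpression_immediate:
  "subexpression c e \<Longrightarrow> immediate_sub b c \<Longrightarrow> subexpression b e"
  unfolding subexpression_def by blast

lemma subexpression_refl: "subexpression e e"
  unfolding subexpression_def by blast

text \<open>By replacement the entries of a formation sequence of \<open>e\<close> form a set. It is
  closed under immediate subexpressions, so it contains every subexpression of \<open>e\<close>, and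
  each entry is itself an expression.\<close>

lemma subexpression_is_expression:
  fixes e :: "'c::gb_without_infinity"
  assumes e: "is_expression \<rho> e" and sub: "subexpression c e"
  shows "is_expression \<rho> c"
proof -
  from e obtain s n where tuple: "is_tuple (successor n) is_set s" and "maps s n e"
    and formed: "\<And>i d. maps s i d \<Longrightarrow> formation_step \<rho> (\<lambda>c. \<exists>j. j \<in>\<^sub>c i \<and> maps s j c) d"
    unfolding is_expression_def by blast
  have "\<forall>x y y'. maps s x y \<and> maps s x y' \<longrightarrow> y = y'"
    using is_functionD[OF is_tuple_D(3)[OF tuple]] by blast
  from replacement[OF this natural_is_set[OF is_tuple_D(1)[OF tuple]]]
  obtain W where "is_set W" and "\<And>y. y \<in>\<^sub>c W \<longleftrightarrow> (\<exists>x. x \<in>\<^sub>c successor n \<and> maps s x y)"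
    by blast
  then have W: "is_set W" "\<And>y. y \<in>\<^sub>c W \<longleftrightarrow> (\<exists>i. maps s i y)"
    using is_tuple_D(5)[OF tuple] by blast+
  have "b \<in>\<^sub>c W" if d: "d \<in>\<^sub>c W" "immediate_sub b d" for b d
  proof -
    from d obtain i where "maps s i d" by (auto simp: W)
    have "\<exists>j. j \<in>\<^sub>c i \<and> maps s j b"
      by (rule immediate_sub_formation_step[OF formed[OF \<open>maps s i d\<close>] _ d(2)])
        (auto dest: maps_sets)
    then show ?thesis by (auto simp: W)
  qed
  moreover have "e \<in>\<^sub>c W" using \<open>maps s n e\<close> by (auto simp: W)
  ultimately have "c \<in>\<^sub>c W" using sub W(1) unfolding subexpression_def by blast
  then show ?thesis using formation_sequence_entry[OF tuple formed] by (auto simp: W)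
qed

lemma in_Sub_upair:
  fixes p q :: "'c::gb_without_infinity"
  assumes "is_set p" "is_set q"
  shows "in_Sub (upair p q) c \<longleftrightarrow> subexpression c p \<or> subexpression c q"
  using assms by (auto simp: in_Sub_def mem_upair)

lemma in_Sub_singleton: "is_set p \<Longrightarrow> in_Sub (singleton p) c \<longleftrightarrow> subexpression c p"
  by (auto simp: in_Sub_def mem_singleton)

text \<open>If closed sets around \<open>p\<close> and around \<open>q\<close> both omit
  \<open>c\<close>, their union with \<open>e\<close> adjoined is again closed and omits every
  \<open>c\<close> other than \<open>e\<close>.\<close>

lemma subexpression_composed:
  fixes e p q :: "'c::gb_without_infinity"
  assumes "is_set e" and imm: "\<And>b. immediate_sub b e \<longleftrightarrow> b = p \<or> b = q"
  shows "subexpression c e \<longleftrightarrow> c = e \<or> subexpression c p \<or> subexpression c q"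
proof
  assume sub: "subexpression c e"
  show "c = e \<or> subexpression c p \<or> subexpression c q"
  proof (rule ccontr)
    assume neg: "\<not> (c = e \<or> subexpression c p \<or> subexpression c q)"
    then obtain W1 W2 where
      W1: "is_set W1" "p \<in>\<^sub>c W1" "\<And>d b. d \<in>\<^sub>c W1 \<Longrightarrow> immediate_sub b d \<Longrightarrow> b \<in>\<^sub>c W1" "\<not> c \<in>\<^sub>c W1" and
      W2: "is_set W2" "q \<in>\<^sub>c W2" "\<And>d b. d \<in>\<^sub>c W2 \<Longrightarrow> immediate_sub b d \<Longrightarrow> b \<in>\<^sub>c W2" "\<not> c \<in>\<^sub>c W2"
      unfolding subexpression_def by blast
    obtain U where U: "is_set U" "\<And>z. z \<in>\<^sub>c U \<longleftrightarrow> z \<in>\<^sub>c W1 \<or> z \<in>\<^sub>c W2"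
      using binary_union[OF W1(1) W2(1)] by blast
    obtain W where W: "is_set W" "\<And>z. z \<in>\<^sub>c W \<longleftrightarrow> z \<in>\<^sub>c U \<or> z \<in>\<^sub>c singleton e"
      using binary_union[OF U(1) singleton_is_set] by blast
    have mem: "z \<in>\<^sub>c W \<longleftrightarrow> z \<in>\<^sub>c W1 \<or> z \<in>\<^sub>c W2 \<or> z = e" for z
      using \<open>is_set e\<close> by (auto simp: W U mem_singleton)
    have "b \<in>\<^sub>c W" if "d \<in>\<^sub>c W" "immediate_sub b d" for d b
      using that W1(2,3) W2(2,3) imm unfolding mem by metis
    moreover have "e \<in>\<^sub>c W" by (simp add: mem)
    ultimately have "c \<in>\<^sub>c W" using sub W(1) unfolding subexpression_def by blast
    with neg W1(4) W2(4) show False by (simp add: mem)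
  qed
next
  assume "c = e \<or> subexpression c p \<or> subexpression c q"
  moreover have "subexpression c e" if "subexpression c p"
    using that imm unfolding subexpression_def by blast
  moreover have "subexpression c e" if "subexpression c q"
    using that imm unfolding subexpression_def by blast
  ultimately show "subexpression c e" using subexpression_refl by blast
qed

section \<open>Valuations\<close>

lemma assignment_is_set: "is_assignment \<SS> e A \<Longrightarrow> is_set A"
  by (simp add: is_assignment_def is_finite_def)

lemma tarskian_at_cong:
  fixes F G :: "'c::gb_without_infinity"
  assumes "is_expression \<rho> e" and "is_set A"
    and eq: "\<And>b B y. b = e \<or> immediate_sub b e \<Longrightarrow> is_set B \<Longrightarrow> val F b B y \<longleftrightarrow> val G b B y"
  shows "tarskian_at \<SS> F e A \<longleftrightarrow> tarskian_at \<SS> G e A"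
proof -
  have "val F e A y \<longleftrightarrow> val G e A y" for y using assms by blast
  then show ?thesis
    using expression_shape(2)[OF assms(1)]
      term_clause_cong[of A e F G \<SS>] truth_clause_cong[of A e F G \<SS>] assms(2) eq
    by (auto simp: tarskian_at_term tarskian_at_formula true_at_def)
qed

text \<open>The condition on \<open>\<Phi>\<close> makes all subexpressions of its members
  expressions, which opens them to induction and to the distinction between terms and
  formulas.\<close>

locale valuation =
  fixes \<rho> :: "'c::gb_without_infinity signature" and \<SS> :: "'c class_structure" and \<Phi> F :: 'c
  assumes expressions: "e \<in>\<^sub>c \<Phi> \<Longrightarrow> is_expression \<rho> e"
    and valuation: "is_valuation \<rho> \<SS> \<Phi> F"
begin

lemma sub_expression: "in_Sub \<Phi> e \<Longrightarrow> is_expression \<rho> e"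
  unfolding in_Sub_def using expressions subexpression_is_expression by blast

lemma sub_set: "in_Sub \<Phi> e \<Longrightarrow> is_set e"
  using sub_expression expression_shape(1) by blast

lemma sub_immediate: "in_Sub \<Phi> e \<Longrightarrow> immediate_sub b e \<Longrightarrow> in_Sub \<Phi> b"
  unfolding in_Sub_def using subexpression_immediate by blast

lemma functional: "is_function F"
  using valuation by (simp add: is_valuation_def)

lemma domain:
  "in_dom z F \<longleftrightarrow> (\<exists>e A. in_Sub \<Phi> e \<and> is_assignment \<SS> e A \<and> z = opair e A)"
  using valuation by (simp add: is_valuation_def)

lemma maps_domain:
  assumes "maps F z y"
  obtains e A where "in_Sub \<Phi> e" "is_assignment \<SS> e A" "z = opair e A"
  using assms domain unfolding in_dom_def by blast

text \<open>The sethood assumptions are what allows \<open>e\<close> and \<open>A\<close> to be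
  recovered from their ordered pair.\<close>

lemma val_domain:
  assumes "val F e A y" "is_set e" "is_set A"
  shows "in_Sub \<Phi> e" "is_assignment \<SS> e A"
proof -
  from assms(1) obtain e' A' where "in_Sub \<Phi> e'" "is_assignment \<SS> e' A'" "opair e A = opair e' A'"
    unfolding val_def by (rule maps_domain)
  with assms(2,3) sub_set assignment_is_set show "in_Sub \<Phi> e" "is_assignment \<SS> e A"
    by (metis opair_inject)+
qed

lemma val_exists: "in_Sub \<Phi> e \<Longrightarrow> is_assignment \<SS> e A \<Longrightarrow> \<exists>y. val F e A y"
  using domain unfolding in_dom_def val_def by blast

lemma val_unique: "val F e A y \<Longrightarrow> val F e A y' \<Longrightarrow> y = y'"
  unfolding val_def using is_functionD[OF functional] .

lemma tarskian: "in_Sub \<Phi> e \<Longrightarrow> is_assignment \<SS> e A \<Longrightarrow> tarskian_at \<SS> F e A"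
  using valuation by (simp add: is_valuation_def)

lemma term_value:
  "in_Sub \<Phi> e \<Longrightarrow> is_assignment \<SS> e A \<Longrightarrow> is_term \<rho> e \<Longrightarrow> val F e A y \<Longrightarrow> y \<in>\<^sub>c universe \<SS>"
  using valuation by (simp add: is_valuation_def)

lemma formula_value:
  "in_Sub \<Phi> e \<Longrightarrow> is_assignment \<SS> e A \<Longrightarrow> is_formula \<rho> e \<Longrightarrow> val F e A y \<Longrightarrow> y = num 0 \<or> y = num 1"
  using valuation unfolding is_valuation_def by blast

end

section \<open>Agreement and union of valuations\<close>

lemma valuations_agree:
  fixes F G :: "'c::gb_without_infinity"
  assumes "valuation \<rho> \<SS> \<Phi> F" and "valuation \<rho> \<SS> \<Psi> G"
    and "in_Sub \<Phi> e" "in_Sub \<Psi> e" "is_set A"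
  shows "val F e A y \<longleftrightarrow> val G e A y"
proof -
  interpret F: valuation \<rho> \<SS> \<Phi> F by fact
  interpret G: valuation \<rho> \<SS> \<Psi> G by fact
  \<comment> \<open>Chosen so that its definability is immediate: it mentions neither subexpressions
    nor assignments, and holds trivially where one of the valuations has no value.\<close>
  define P where "P e \<longleftrightarrow> (\<forall>\<^sub>s A. \<forall>\<^sub>s y. \<forall>\<^sub>s y'. val F e A y \<longrightarrow> val G e A y' \<longrightarrow> y = y')" for e
  \<comment> \<open>The weak statement \<open>P\<close> gives the full equivalence, since at a
    common subexpression both valuations are defined for exactly the same assignments.\<close>
  have transfer: "val F b B y \<longleftrightarrow> val G b B y"
    if b: "P b" "in_Sub \<Phi> b" "in_Sub \<Psi> b" "is_set B" for b B y
  proof -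
    have "is_set b" using F.sub_set b(2) .
    have sets: "is_set z" if "val H b B z" for H z
      using that by (simp add: val_def maps_sets)
    show ?thesis
    proof
      assume y: "val F b B y"
      then obtain y' where "val G b B y'"
        using F.val_domain[OF y \<open>is_set b\<close>] G.val_exists b by blast
      with y b(1,4) sets show "val G b B y" unfolding P_def by metis
    next
      assume y: "val G b B y"
      then obtain y' where "val F b B y'"
        using G.val_domain[OF y \<open>is_set b\<close>] F.val_exists b by blast
      with y b(1,4) sets show "val F b B y" unfolding P_def by metis
    qed
  qed
  have "P e"
  proof (rule expression_induct[where P = P, OF F.sub_expression[OF assms(3)]])
    show "definable (\<lambda>s. P (s 0))"
      unfolding P_def val_def by (intro definable_intros definable_maps definable_term_opair)
  next
    fix c assume c: "is_expression \<rho> c" and IH: "\<And>b. immediate_sub b c \<Longrightarrow> P b"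
    show "P c"
      unfolding P_def
    proof (intro allI impI)
      fix A y y' assume A: "is_set A" and y: "val F c A y" "val G c A y'"
      have set: "is_set c" using expression_shape(1)[OF c] .
      note sub = F.val_domain[OF y(1) set A] G.val_domain[OF y(2) set A]
      have eq: "val F b B z \<longleftrightarrow> val G b B z" if "immediate_sub b c" "is_set B" for b B z
        using transfer IH F.sub_immediate G.sub_immediate sub that by blast
      show "y = y'"
      proof (cases "term_shaped c")
        case True
        then have "val F c A y \<longleftrightarrow> val G c A y"
          using F.tarskian[OF sub(1,2)] G.tarskian[OF sub(3,4)] term_clause_cong[OF A eq, where \<SS> = \<SS>]
          by (simp add: tarskian_at_term)
        with y G.val_unique show ?thesis by blast
      next
        case False
        with expression_shape(2)[OF c] have shape: "formula_shaped c" by blast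
        have "true_at F c A \<longleftrightarrow> true_at G c A"
          using F.tarskian[OF sub(1,2)] G.tarskian[OF sub(3,4)] truth_clause_cong[OF A eq, where \<SS> = \<SS>] shape
          by (simp add: tarskian_at_formula)
        \<comment> \<open>For formulas the clauses only decide whether the value is
          \<open>num 1\<close>. Equality of the values needs in addition that both are truth
          values.\<close>
        moreover have "is_formula \<rho> c" using c False by (simp add: is_formula_def)
        then have "y = num 0 \<or> y = num 1" "y' = num 0 \<or> y' = num 1"
          using F.formula_value[OF sub(1,2)] G.formula_value[OF sub(3,4)] y by blast+
        moreover have "true_at F c A \<longleftrightarrow> y = num 1" "true_at G c A \<longleftrightarrow> y' = num 1"
          unfolding true_at_def using y F.val_unique G.val_unique by blast+
        ultimately show ?thesis by auto
      qed
    qed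
  qed
  with transfer assms show ?thesis by blast
qed

lemma valuation_union:
  fixes F G :: "'c::gb_without_infinity"
  assumes "valuation \<rho> \<SS> \<Phi> F" and "valuation \<rho> \<SS> \<Psi> G"
    and K: "\<And>z. z \<in>\<^sub>c K \<longleftrightarrow> z \<in>\<^sub>c F \<or> z \<in>\<^sub>c G"
    and Sub: "\<And>c. in_Sub \<Theta> c \<longleftrightarrow> in_Sub \<Phi> c \<or> in_Sub \<Psi> c"
  shows "is_valuation \<rho> \<SS> \<Theta> K"
proof -
  interpret F: valuation \<rho> \<SS> \<Phi> F by fact
  interpret G: valuation \<rho> \<SS> \<Psi> G by fact
  have maps: "maps K x y \<longleftrightarrow> maps F x y \<or> maps G x y" for x y
    by (auto simp: maps_def K)
  note agree = valuations_agree[OF assms(1,2)]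
  have val: "val K c B y \<longleftrightarrow> val F c B y \<or> val G c B y" for c B y
    by (simp add: val_def maps)
  \<comment> \<open>Any value contributed by \<open>G\<close> at such a \<open>c\<close> puts
    \<open>c\<close> among the subexpressions of \<open>\<Psi>\<close> too, so agreement turns it
    into a value of \<open>F\<close>.\<close>
  have val_F: "val K c B y \<longleftrightarrow> val F c B y" if "in_Sub \<Phi> c" "is_set B" for c B y
    using that agree G.val_domain(1) F.sub_set unfolding val by blast
  have val_G: "val K c B y \<longleftrightarrow> val G c B y" if "in_Sub \<Psi> c" "is_set B" for c B y
    using that agree F.val_domain(1) G.sub_set unfolding val by blast
  have cross: "y = y'" if y: "maps F x y" "maps G x y'" for x y y'
  proof -
    obtain e A where e: "in_Sub \<Phi> e" "is_assignment \<SS> e A" "x = opair e A"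
      using F.maps_domain[OF y(1)] .
    have "val G e A y'" using y(2) by (simp add: val_def e(3))
    moreover from this have "in_Sub \<Psi> e"
      using G.val_domain(1) F.sub_set[OF e(1)] assignment_is_set[OF e(2)] by blast
    ultimately have "val F e A y'" using agree e assignment_is_set by blast
    moreover have "val F e A y" using y(1) by (simp add: val_def e(3))
    ultimately show ?thesis using F.val_unique by blast
  qed
  show ?thesis
    unfolding is_valuation_def
  proof (intro conjI)
    show "is_function K"
      unfolding is_function_def maps
    proof (intro conjI allI impI)
      show "\<exists>\<^sub>s x. \<exists>\<^sub>s y. p = opair x y" if "p \<in>\<^sub>c K" for p
        using that F.functional G.functional unfolding K is_function_def by blast
      show "y = y'" if "(maps F x y \<or> maps G x y) \<and> (maps F x y' \<or> maps G x y')" for x y y'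
        using that cross is_functionD[OF F.functional] is_functionD[OF G.functional] by metis
    qed
    show "\<forall>p. in_dom p K \<longleftrightarrow>
        (\<exists>e A. in_Sub \<Theta> e \<and> is_assignment \<SS> e A \<and> p = opair e A)"
    proof -
      have "in_dom p K \<longleftrightarrow> in_dom p F \<or> in_dom p G" for p
        by (auto simp: in_dom_def maps)
      then show ?thesis unfolding Sub F.domain G.domain by blast
    qed
    show "\<forall>e A. in_Sub \<Theta> e \<and> is_assignment \<SS> e A \<longrightarrow>
        (is_term \<rho> e \<longrightarrow> (\<forall>y. val K e A y \<longrightarrow> y \<in>\<^sub>c universe \<SS>)) \<and>
        (is_formula \<rho> e \<longrightarrow> (\<forall>y. val K e A y \<longrightarrow> y = num 0 \<or> y = num 1)) \<and>
        tarskian_at \<SS> K e A"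
    proof (intro allI impI)
      fix e A assume "in_Sub \<Theta> e \<and> is_assignment \<SS> e A"
      then have A: "is_assignment \<SS> e A" "is_set A" and "in_Sub \<Phi> e \<or> in_Sub \<Psi> e"
        using assignment_is_set by (auto simp: Sub)
      from this(3) show "(is_term \<rho> e \<longrightarrow> (\<forall>y. val K e A y \<longrightarrow> y \<in>\<^sub>c universe \<SS>)) \<and>
        (is_formula \<rho> e \<longrightarrow> (\<forall>y. val K e A y \<longrightarrow> y = num 0 \<or> y = num 1)) \<and>
        tarskian_at \<SS> K e A"
      proof
        assume e: "in_Sub \<Phi> e"
        have "tarskian_at \<SS> K e A \<longleftrightarrow> tarskian_at \<SS> F e A"
          by (rule tarskian_at_cong[OF F.sub_expression[OF e] A(2)])
            (use val_F e F.sub_immediate in blast)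
        then show ?thesis
          using F.tarskian[OF e A(1)] F.term_value[OF e A(1)] F.formula_value[OF e A(1)]
            val_F[OF e A(2)] by blast
      next
        assume e: "in_Sub \<Psi> e"
        have "tarskian_at \<SS> K e A \<longleftrightarrow> tarskian_at \<SS> G e A"
          by (rule tarskian_at_cong[OF G.sub_expression[OF e] A(2)])
            (use val_G e G.sub_immediate in blast)
        then show ?thesis
          using G.tarskian[OF e A(1)] G.term_value[OF e A(1)] G.formula_value[OF e A(1)]
            val_G[OF e A(2)] by blast
      qed
    qed
  qed
qed

section \<open>Extension of a valuation by one formula\<close>

lemma definable_val:
  fixes t u v w :: "(nat \<Rightarrow> 'c::gb_without_infinity) \<Rightarrow> 'c"
  assumes "definable_term t" "definable_term u" "definable_term v" "definable_term w"
  shows "definable (\<lambda>s. val (t s) (u s) (v s) (w s))"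
  unfolding val_def by (intro definable_maps definable_term_opair assms)

lemma definable_value_tuple:
  "definable (\<lambda>s. value_tuple F (s i) (s j) (s k :: 'c::gb_without_infinity))"
  unfolding value_tuple_def
  by (intro definable_set_intros definable_val definable_is_function)
    (auto simp: val_def dest: maps_sets)

lemma definable_truth_clause:
  "definable (\<lambda>s. truth_clause \<SS> F e (s i :: 'c::gb_without_infinity))"
  unfolding truth_clause_def constructor_defs true_at_def
  by (intro definable_set_intros definable_val definable_value_tuple definable_term_update)
    (auto simp: val_def value_tuple_def dest: maps_sets is_setI)

lemma valuation_extension:
  fixes F e :: "'c::gb_without_infinity"
  assumes "valuation \<rho> \<SS> \<Phi> F"
    and shape: "formula_shaped e" and set: "is_set e" and new: "\<not> in_Sub \<Phi> e"
    and imm: "\<And>b. immediate_sub b e \<Longrightarrow> in_Sub \<Phi> b"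
    and Sub: "\<And>c. in_Sub \<Theta> c \<longleftrightarrow> c = e \<or> in_Sub \<Phi> c"
  obtains H where "is_valuation \<rho> \<SS> \<Theta> H"
    and "\<And>c A y. c \<noteq> e \<Longrightarrow> is_set c \<Longrightarrow> is_set A \<Longrightarrow> val H c A y \<longleftrightarrow> val F c A y"
proof -
  interpret F: valuation \<rho> \<SS> \<Phi> F by fact
  \<comment> \<open>The truth clause is evaluated in \<open>F\<close>, not in the valuation under
    construction. This is not circular, as it concerns only immediate subexpressions of
    \<open>e\<close>, which \<open>imm\<close> places among the subexpressions of
    \<open>\<Phi>\<close>.\<close>
  define N where "N A y \<longleftrightarrow> is_assignment \<SS> e A \<and>
    (truth_clause \<SS> F e A \<and> y = num 1 \<or> \<not> truth_clause \<SS> F e A \<and> y = num 0)" for A y :: 'c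
  have "definable (\<lambda>s. s 0 \<in>\<^sub>c F \<or> (\<exists>\<^sub>s A. \<exists>\<^sub>s y. N A y \<and> s 0 = opair (opair e A) y))"
    unfolding N_def
    by (intro definable_intros definable_is_assignment definable_truth_clause definable_term_opair)
  then obtain H where H: "\<And>z. z \<in>\<^sub>c H \<longleftrightarrow> is_set z \<and>
      (z \<in>\<^sub>c F \<or> (\<exists>\<^sub>s A. \<exists>\<^sub>s y. N A y \<and> z = opair (opair e A) y))"
    by (rule class_comprehension) (rule that)
  have N_sets: "is_set A" "is_set y" if "N A y" for A y
    using that assignment_is_set unfolding N_def by auto
  have N_unique: "N A y \<Longrightarrow> N A y' \<Longrightarrow> y = y'" for A y y'
    unfolding N_def by blast
  have maps: "maps H z y \<longleftrightarrow> maps F z y \<or> (\<exists>A. N A y \<and> z = opair e A)" for z y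
  proof
    assume "maps H z y"
    then show "maps F z y \<or> (\<exists>A. N A y \<and> z = opair e A)"
      by (auto simp: maps_def H)
  next
    assume "maps F z y \<or> (\<exists>A. N A y \<and> z = opair e A)"
    then show "maps H z y"
    proof (elim disjE exE conjE)
      fix A assume "N A y" "z = opair e A"
      then show ?thesis
        unfolding maps_def H using N_sets
        by (intro conjI disjI2 exI[of _ A] exI[of _ y]) simp_all
    qed (simp add: maps_def H)
  qed
  have old: "val H c A y \<longleftrightarrow> val F c A y" if "c \<noteq> e" "is_set c" "is_set A" for c A y
    using that set N_sets unfolding val_def maps by (metis opair_inject)
  \<comment> \<open>No old value can conflict with the added ones, because \<open>F\<close> has none
    at \<open>e\<close>.\<close>
  have F_new: "\<not> maps F (opair e A) y" if "is_set A" for A y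
    using F.val_domain(1)[OF _ set that] new by (auto simp: val_def)
  have val_new: "val H e A y \<longleftrightarrow> N A y" if "is_set A" for A y
    using that set N_sets F_new unfolding val_def maps by (metis opair_inject)
  have "is_valuation \<rho> \<SS> \<Theta> H"
    unfolding is_valuation_def
  proof (intro conjI)
    show "is_function H"
      unfolding is_function_def
    proof (intro conjI allI impI)
      show "\<exists>\<^sub>s x. \<exists>\<^sub>s y. p = opair x y" if "p \<in>\<^sub>c H" for p
        using that F.functional unfolding H is_function_def by (metis is_set_opair)
      show "y = y'" if "maps H x y \<and> maps H x y'" for x y y'
        using that set N_sets N_unique F_new is_functionD[OF F.functional] unfolding maps
        by (metis opair_inject)
    qed
    show "\<forall>p. in_dom p H \<longleftrightarrow>
        (\<exists>c A. in_Sub \<Theta> c \<and> is_assignment \<SS> c A \<and> p = opair c A)"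
    proof -
      have "(\<exists>y. N A y) \<longleftrightarrow> is_assignment \<SS> e A" for A unfolding N_def by blast
      then have "in_dom p H \<longleftrightarrow> in_dom p F \<or> (\<exists>A. is_assignment \<SS> e A \<and> p = opair e A)" for p
        unfolding in_dom_def maps by blast
      then show ?thesis unfolding Sub F.domain by blast
    qed
    show "\<forall>c A. in_Sub \<Theta> c \<and> is_assignment \<SS> c A \<longrightarrow>
        (is_term \<rho> c \<longrightarrow> (\<forall>y. val H c A y \<longrightarrow> y \<in>\<^sub>c universe \<SS>)) \<and>
        (is_formula \<rho> c \<longrightarrow> (\<forall>y. val H c A y \<longrightarrow> y = num 0 \<or> y = num 1)) \<and>
        tarskian_at \<SS> H c A"
    proof (intro allI impI)
      fix c A assume "in_Sub \<Theta> c \<and> is_assignment \<SS> c A"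
      then have A: "is_assignment \<SS> c A" "is_set A" and "c = e \<or> in_Sub \<Phi> c"
        using assignment_is_set by (auto simp: Sub)
      have old_Sub: "val H b B y \<longleftrightarrow> val F b B y" if "in_Sub \<Phi> b" "is_set B" for b B y
        using old new that F.sub_set by metis
      from \<open>c = e \<or> in_Sub \<Phi> c\<close>
      show "(is_term \<rho> c \<longrightarrow> (\<forall>y. val H c A y \<longrightarrow> y \<in>\<^sub>c universe \<SS>)) \<and>
        (is_formula \<rho> c \<longrightarrow> (\<forall>y. val H c A y \<longrightarrow> y = num 0 \<or> y = num 1)) \<and>
        tarskian_at \<SS> H c A"
      proof
        assume c: "c = e"
        have "truth_clause \<SS> H e A \<longleftrightarrow> truth_clause \<SS> F e A"
          by (rule truth_clause_cong[OF A(2)]) (rule old_Sub[OF imm])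
        then have "tarskian_at \<SS> H e A"
          using A(1) unfolding tarskian_at_formula[OF shape] true_at_def val_new[OF A(2)] N_def c
          by auto
        moreover have "\<not> is_term \<rho> e"
          using formula_not_term_shaped[OF shape] by (simp add: is_term_def)
        ultimately show ?thesis
          unfolding c val_new[OF A(2)] N_def by blast
      next
        assume c: "in_Sub \<Phi> c"
        have "tarskian_at \<SS> H c A \<longleftrightarrow> tarskian_at \<SS> F c A"
          by (rule tarskian_at_cong[OF F.sub_expression[OF c] A(2)])
            (use old_Sub c F.sub_immediate in blast)
        then show ?thesis
          using F.tarskian[OF c A(1)] F.term_value[OF c A(1)] F.formula_value[OF c A(1)]
            old_Sub[OF c A(2)] by blast
      qed
    qed
  qed
  from this old show thesis by (rule that)
qed

section \<open>Satisfaction relations\<close>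

lemma satisfaction_relation_composed:
  fixes e p q :: "'c::gb_without_infinity"
  assumes p: "is_formula \<rho> p" "\<exists>R. is_satisfaction_relation \<rho> \<SS> (singleton p) R"
    and q: "is_formula \<rho> q" "\<exists>R. is_satisfaction_relation \<rho> \<SS> (singleton q) R"
    and shape: "formula_shaped e" and set: "is_set e"
    and imm: "\<And>b. immediate_sub b e \<longleftrightarrow> b = p \<or> b = q"
  shows "\<exists>R. is_satisfaction_relation \<rho> \<SS> (singleton e) R"
proof -
  have expr: "is_expression \<rho> p" "is_expression \<rho> q"
    using p(1) q(1) by (simp_all add: is_formula_def)
  note sets = expr[THEN expression_shape(1)]
  obtain Rp F where F: "is_valuation \<rho> \<SS> (singleton p) F"
    and Rp: "\<And>z. z \<in>\<^sub>c Rp \<longleftrightarrow>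
      (\<exists>\<^sub>s c. \<exists>\<^sub>s A. z = opair c A \<and> is_formula \<rho> c \<and> val F c A (num 1))"
    using p(2) unfolding is_satisfaction_relation_def by blast
  obtain Rq G where G: "is_valuation \<rho> \<SS> (singleton q) G"
    and Rq: "\<And>z. z \<in>\<^sub>c Rq \<longleftrightarrow>
      (\<exists>\<^sub>s c. \<exists>\<^sub>s A. z = opair c A \<and> is_formula \<rho> c \<and> val G c A (num 1))"
    using q(2) unfolding is_satisfaction_relation_def by blast
  have F: "valuation \<rho> \<SS> (singleton p) F"
    using F expr by unfold_locales (auto simp: mem_singleton)
  have G: "valuation \<rho> \<SS> (singleton q) G"
    using G expr by unfold_locales (auto simp: mem_singleton)
  have "definable (\<lambda>s. s 0 \<in>\<^sub>c F \<or> s 0 \<in>\<^sub>c G)" by (intro definable_intros)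
  then obtain K where "\<And>z. z \<in>\<^sub>c K \<longleftrightarrow> is_set z \<and> (z \<in>\<^sub>c F \<or> z \<in>\<^sub>c G)"
    by (rule class_comprehension) (rule that)
  then have K: "\<And>z. z \<in>\<^sub>c K \<longleftrightarrow> z \<in>\<^sub>c F \<or> z \<in>\<^sub>c G" using is_setI by blast
  have Sub: "in_Sub (upair p q) c \<longleftrightarrow> in_Sub (singleton p) c \<or> in_Sub (singleton q) c" for c
    by (simp add: sets in_Sub_upair in_Sub_singleton)
  have val_K: "is_valuation \<rho> \<SS> (upair p q) K"
    by (rule valuation_union[OF F G K Sub])
  interpret K: valuation \<rho> \<SS> "upair p q" K
    using val_K expr by unfold_locales (auto simp: mem_upair)
  have Sub_e: "in_Sub (singleton e) c \<longleftrightarrow> c = e \<or> in_Sub (upair p q) c" for c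
    by (simp add: set sets in_Sub_upair in_Sub_singleton subexpression_composed[OF set imm])
  obtain H where H: "is_valuation \<rho> \<SS> (singleton e) H"
    and HK: "\<And>c A y. c \<noteq> e \<Longrightarrow> is_set c \<Longrightarrow> is_set A \<Longrightarrow> val H c A y \<longleftrightarrow> val K c A y"
  proof (cases "in_Sub (upair p q) e")
    \<comment> \<open>Treating this case separately spares a proof that no formula is a
      subexpression of its own immediate subexpressions.\<close>
    case True
    then have "in_Sub (singleton e) c \<longleftrightarrow> in_Sub (upair p q) c" for c
      using Sub_e by metis
    then have "is_valuation \<rho> \<SS> (singleton e) K"
      using val_K by (simp add: is_valuation_def)
    then show thesis using that by blast
  next
    case False
    have "in_Sub (upair p q) b" if "immediate_sub b e" for b
      using that subexpression_refl unfolding imm in_Sub_upair[OF sets] by blast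
    from valuation_extension[OF K.valuation_axioms shape set False this Sub_e] that
    show thesis by blast
  qed
  \<comment> \<open>For first components other than \<open>e\<close>, the test for being a formula
    is inherited from \<open>Rp\<close> and \<open>Rq\<close>; for \<open>e\<close> it is a constant
    truth value. Pairs starting with \<open>e\<close> are removed from the given relations and
    decided by \<open>H\<close> alone.\<close>
  have "definable (\<lambda>s. (s 0 \<in>\<^sub>c Rp \<or> s 0 \<in>\<^sub>c Rq) \<and> \<not> (\<exists>\<^sub>s A. s 0 = opair e A) \<or>
      (\<exists>\<^sub>s A. s 0 = opair e A \<and> is_formula \<rho> e \<and> val H e A (num 1)))"
    by (intro definable_intros definable_term_opair definable_val)
  then obtain R where R: "\<And>z. z \<in>\<^sub>c R \<longleftrightarrow> is_set z \<and>
      ((z \<in>\<^sub>c Rp \<or> z \<in>\<^sub>c Rq) \<and> \<not> (\<exists>\<^sub>s A. z = opair e A) \<or>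
       (\<exists>\<^sub>s A. z = opair e A \<and> is_formula \<rho> e \<and> val H e A (num 1)))"
    by (rule class_comprehension) (rule that)
  have val_K_iff: "val K c A y \<longleftrightarrow> val F c A y \<or> val G c A y" for c A y
    by (auto simp: val_def maps_def K)
  have "z \<in>\<^sub>c R \<longleftrightarrow> (\<exists>\<^sub>s c. \<exists>\<^sub>s A. z = opair c A \<and> is_formula \<rho> c \<and> val H c A (num 1))" for z
  proof (cases "\<exists>\<^sub>s c. \<exists>\<^sub>s A. z = opair c A")
    case False
    then show ?thesis unfolding R Rp Rq using set by blast
  next
    case True
    then obtain c A where z: "is_set c" "is_set A" "z = opair c A" by blast
    show ?thesis
    proof (cases "c = e")
      case True
      with z set show ?thesis by (auto simp: R cong: conj_cong)
    next
      case False
      with z set show ?thesis by (auto simp: R Rp Rq HK val_K_iff cong: conj_cong)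
    qed
  qed
  with H show ?thesis unfolding is_satisfaction_relation_def by blast
qed

theorem theorem2p5:
  fixes \<rho> :: "'c::gb_without_infinity signature"
    and \<SS> :: "'c class_structure"
    and \<phi> \<psi> \<psi>' :: 'c
  assumes "is_signature \<rho>"
    and "is_structure \<rho> \<SS>"
    and "is_formula \<rho> \<psi>"
    and "is_formula \<rho> \<psi>'"
    and "\<exists>R. is_satisfaction_relation \<rho> \<SS> (singleton \<psi>) R"
    and "\<exists>R. is_satisfaction_relation \<rho> \<SS> (singleton \<psi>') R"
    and "\<exists>p\<in>{\<psi>, \<psi>'}. \<exists>q\<in>{\<psi>, \<psi>'}.
           \<phi> = Neg p \<or> \<phi> = Or p q \<or> \<phi> = And p q \<or> \<phi> = Imp p q \<or> \<phi> = Iff p q \<or>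
           (\<exists>v. is_var v \<and> (\<phi> = ExQ v p \<or> \<phi> = AllQ v p))"
  shows "\<exists>R. is_satisfaction_relation \<rho> \<SS> (singleton \<phi>) R"
proof -
  from assms(7) obtain p q where pq: "p \<in> {\<psi>, \<psi>'}" "q \<in> {\<psi>, \<psi>'}"
    and \<phi>: "\<phi> = Neg p \<or> \<phi> = Or p q \<or> \<phi> = And p q \<or> \<phi> = Imp p q \<or> \<phi> = Iff p q \<or>
      (\<exists>v. is_var v \<and> (\<phi> = ExQ v p \<or> \<phi> = AllQ v p))"
    by blast
  have formulas: "is_formula \<rho> r" "\<exists>R. is_satisfaction_relation \<rho> \<SS> (singleton r) R"
    if "r \<in> {\<psi>, \<psi>'}" for r
    using that assms(3-6) by auto
  have sets: "is_set p" "is_set q"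
    using pq formulas(1) expression_shape(1) unfolding is_formula_def by blast+
  have "is_set \<phi>"
    using \<phi> by (auto simp: constructor_defs)
  have "formula_shaped \<phi>"
    using \<phi> sets by (auto simp: var_is_set)
  \<comment> \<open>Negation and quantification count as composed of \<open>p\<close> and
    \<open>p\<close>, which brings the unary and the binary operations under one statement.\<close>
  have "(\<forall>b. immediate_sub b \<phi> \<longleftrightarrow> b = p \<or> b = p) \<or> (\<forall>b. immediate_sub b \<phi> \<longleftrightarrow> b = p \<or> b = q)"
    using \<phi> sets by (auto simp: var_is_set)
  then obtain r where "r \<in> {p, q}" and "\<And>b. immediate_sub b \<phi> \<longleftrightarrow> b = p \<or> b = r"
    by blast
  with pq show ?thesis
    using satisfaction_relation_composed[OF _ _ _ _ \<open>formula_shaped \<phi>\<close> \<open>is_set \<phi>\<close>] formulas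
    by (metis insert_iff singletonD)
qed

end
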